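(* Let $c>0$ be fixed and $p=c/n$, and let $P=P_{\mathcal{G}(n,p)}$. Suppose $\xi,\beta$ are fixed positive reals such that $\xi+\alpha_c<1/2$ and $\sup_{t\le \alpha_c} f(c,\xi,\beta,t)<0$, where \begin{align*} f(c,\xi,\beta,t)=&\ \beta\log(e\xi/\beta)-c\beta(1/2-\xi-t)+\frac{1}{c}\left(Li_2(1)-Li_2(e^{-ct})\right)\\ &+\frac{1}{c}\left(Li_2(e^{-c\beta-ct})-Li_2(e^{-c\beta})+Li_2(e^{-c(1/2-\xi-t)-ct})-Li_2(e^{-c(1/2-\xi-t)})\right). \end{align*} Then (a) asymptotically almost surely $\dim P\ge \xi/(2\beta)$; (b) there exist constants $\gamma=\gamma(c)>0$ with $\lim_{c\to\infty}\gamma(c)=1/6$ such that asymptotically almost surely $\dim P\ge e^{\gamma c}$.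
   Context: $Li_2(z)=-\int_0^z y^{-1}\log(1-y)\,dy$ is the dilogarithm. For $c>0$, $\alpha_c$ is the unique positive solution $x$ of $\frac{e^2}{x^2}e^{-cx}=1$. $\mathcal{G}(n,p)$ is the Erdős–Rényi random graph on $[n]$. $P_{\mathcal{G}(n,p)}$ is the poset on $[n]$ in which $i<_P j$ iff there are vertices $i=u_1<u_2<\dots<u_k=j$ (natural order) such that $u_1u_2\cdots u_k$ is a path in $\mathcal{G}(n,p)$. The dimension of a poset is the minimum number of linear orders whose intersection is its order. Asymptotically almost surely means with probability tending to 1 as $n\to\infty$. *)

theory Defs
  imports "HOL-Probability.Probability"
begin

(* The integrand is read in the Henstock--Kurzweil sense. Its junk values at y = 0 and y = 1 are
   irrelevant (null sets); intended for z \<le> 1, including z = 1. *)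
definition Li2 :: "real \<Rightarrow> real" where
  "Li2 z = - integral {0..z} (\<lambda>y. ln (1 - y) / y)"

definition alpha :: "real \<Rightarrow> real" where
  "alpha c = (THE x. x > 0 \<and> exp 2 / x\<^sup>2 * exp (- c * x) = 1)"

definition dim_rate :: "real \<Rightarrow> real \<Rightarrow> real \<Rightarrow> real \<Rightarrow> real" where
  "dim_rate c \<xi> \<beta> t =
     \<beta> * ln (exp 1 * \<xi> / \<beta>) - c * \<beta> * (1/2 - \<xi> - t) + 1 / c * (Li2 1 - Li2 (exp (- c * t)))
     + 1 / c * (Li2 (exp (- c * \<beta> - c * t)) - Li2 (exp (- c * \<beta>))
                + Li2 (exp (- c * (1/2 - \<xi> - t) - c * t)) - Li2 (exp (- c * (1/2 - \<xi> - t))))"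

definition all_edges :: "nat \<Rightarrow> nat set set" where
  "all_edges n = {e. e \<subseteq> {1..n} \<and> card e = 2}"

(* A graph on the vertex set {1..n} is represented by its set of edges. *)
definition erdos_renyi :: "nat \<Rightarrow> real \<Rightarrow> nat set set pmf" where
  "erdos_renyi n p =
     map_pmf (\<lambda>b. {e \<in> all_edges n. b e}) (Pi_pmf (all_edges n) False (\<lambda>_. bernoulli_pmf p))"

definition is_path :: "'a set set \<Rightarrow> 'a list \<Rightarrow> bool" where
  "is_path E us \<longleftrightarrow> distinct us \<and> successively (\<lambda>u v. {u, v} \<in> E) us"

definition graph_less :: "nat \<Rightarrow> nat set set \<Rightarrow> nat \<Rightarrow> nat \<Rightarrow> bool" where
  "graph_less n E i j \<longleftrightarrow>
     (\<exists>us. length us \<ge> 2 \<and> set us \<subseteq> {1..n} \<and> hd us = i \<and> last us = j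
         \<and> sorted_wrt (<) us \<and> is_path E us)"

definition graph_poset :: "nat \<Rightarrow> nat set set \<Rightarrow> nat rel" where
  "graph_poset n E = {(i, j). i \<in> {1..n} \<and> j \<in> {1..n} \<and> (i = j \<or> graph_less n E i j)}"

(* Reflexive orders on the carrier A, as in linear_order_on. *)
definition poset_dim :: "'a set \<Rightarrow> 'a rel \<Rightarrow> nat" where
  "poset_dim A r =
     (LEAST k. \<exists>Ls. finite Ls \<and> card Ls = k \<and> (\<forall>L\<in>Ls. linear_order_on A L) \<and> \<Inter>Ls = r)"

definition aas :: "(nat \<Rightarrow> 'a pmf) \<Rightarrow> (nat \<Rightarrow> 'a \<Rightarrow> bool) \<Rightarrow> bool" where
  "aas M Q \<longleftrightarrow> (\<lambda>n. measure_pmf.prob (M n) {x. Q n x}) \<longlonglongrightarrow> 1"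

end

theory Submission
  imports Defs "HOL-Real_Asymp.Real_Asymp"
begin

text \<open>
  Cut a linear extension $L$ of $P$ at its first $h = \lfloor n/2 \rfloor$ elements $H$. The sets
  $S = \{1..h\} \setminus H$ and $T = H \setminus \{1..h\}$ have the same size and no edge between
  them, so a.a.s. that size is less than $(\alpha_c + \beta) n$. Moreover $S$ is closed under
  taking larger neighbours within $\{1..h\}$. If $S$ contained a set $R$ of $\beta n$ of the first
  $\xi n$ vertices, then it would contain everything reached from $R$ up to $h$, so at most
  $\alpha_c n$ new vertices. Exploring the vertices one at a time, the probability of reaching
  exactly $s$ new ones is a Gaussian binomial coefficient times explicit factors; together with the
  number of choices of $R$ this is $\exp(n f(c,\xi,\beta,s/n) + O(1))$, where the dilogarithms come
  from sums of $\log(1 - e^{-cj/n})$. So a.a.s. every linear extension keeps all but $\beta n$ of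
  the first $\xi n$ vertices in $H$ and, dually, all but $\beta n$ of the last $\xi n$ out of $H$.
  With fewer than $\xi/(2\beta)$ linear extensions, a set of linear size at each end is thus never
  reversed and hence completely comparable, whereas the expected number of comparable pairs is at
  most $n e^c$.

  For (b), $\xi = 1/100$ and $\beta = e^{-c/5}$ satisfy the hypothesis once $c$ is large, which
  even allows the constant exponent $1/6$ there; for small $c$ it suffices that a.a.s. $P$ is not
  a chain.
\<close>

section \<open>Linear extensions and the exploration process\<close>

lemma finite_linear_order_min:
  assumes L: "linear_order_on A L" and "finite B" "B \<noteq> {}" "B \<subseteq> A"
  shows "\<exists>x\<in>B. \<forall>y\<in>B. (x, y) \<in> L"
  using assms(2-4)
proof (induction B rule: finite_ne_induct)
  case (singleton x)
  then show ?case
    using L by (auto simp: order_on_defs refl_on_def)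
next
  case (insert x F)
  then obtain z where z: "z \<in> F" "\<forall>y\<in>F. (z, y) \<in> L" by auto
  have refl: "(x, x) \<in> L" and tr: "trans L"
    using L insert.prems by (auto simp: order_on_defs refl_on_def)
  have "(x, z) \<in> L \<or> (z, x) \<in> L"
    using L insert z refl unfolding order_on_defs total_on_def by (metis insert_subset subsetD)
  then show ?case
    using z refl tr by (auto dest: transD)
qed

text \<open>The segment grows one element at a time: the next element is the least one outside
  \<open>H\<close>.\<close>

lemma linear_order_initial_segment:
  assumes L: "linear_order_on A L" and "finite A" "k \<le> card A"
  shows "\<exists>H\<subseteq>A. card H = k \<and> (\<forall>x\<in>H. \<forall>y\<in>A - H. (x, y) \<in> L)"
  using assms(3)
proof (induction k)
  case 0
  then show ?case by (intro exI[of _ "{}"]) auto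
next
  case (Suc k)
  then obtain H where H: "H \<subseteq> A" "card H = k" "\<forall>x\<in>H. \<forall>y\<in>A - H. (x, y) \<in> L" by auto
  have "A - H \<noteq> {}" using H Suc.prems by auto
  then obtain x where x: "x \<in> A - H" "\<forall>y\<in>A - H. (x, y) \<in> L"
    using finite_linear_order_min[OF L, of "A - H"] \<open>finite A\<close> by auto
  show ?case
    using H x \<open>finite A\<close> by (intro exI[of _ "insert x H"]) (auto simp: finite_subset)
qed

text \<open>\<open>r'\<close> is the transitive closure of \<open>r\<close> with
  \<open>(x, y)\<close> added. A chain using the new pair twice would need some
  \<open>(y, b)\<close> and \<open>(b, x)\<close> in \<open>r\<close>, hence \<open>(y, x)\<close>
  in \<open>r\<close>, which is excluded; the same exclusion saves antisymmetry.\<close>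

lemma partial_order_on_add_pair:
  assumes r: "partial_order_on A r" and xy: "x \<in> A" "y \<in> A" "(y, x) \<notin> r"
  defines "r' \<equiv> r \<union> {(a, b). (a, x) \<in> r \<and> (y, b) \<in> r}"
  shows "partial_order_on A r'" "(x, y) \<in> r'"
proof -
  note p = partial_order_onD[OF r]
  have refl: "\<And>a. a \<in> A \<Longrightarrow> (a, a) \<in> r"
    using p(1) by (auto simp: refl_on_def)
  show "(x, y) \<in> r'" unfolding r'_def using refl xy by auto
  have tr: "\<And>a b d. (a, b) \<in> r \<Longrightarrow> (b, d) \<in> r \<Longrightarrow> (a, d) \<in> r"
    using p(2) by (blast dest: transD)
  have as: "\<And>a b. (a, b) \<in> r \<Longrightarrow> (b, a) \<in> r \<Longrightarrow> a = b"
    using p(3) by (blast dest: antisymD)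
  have "trans r'"
    by (rule transI) (unfold r'_def, use tr xy(3) in blast)
  moreover have "antisym r'"
    by (rule antisymI) (unfold r'_def, use tr as xy(3) in blast)
  moreover have "r' \<subseteq> A \<times> A" "refl_on A r'"
    using p(1,4) by (auto simp: r'_def refl_on_def)
  ultimately show "partial_order_on A r'"
    by (simp add: order_on_defs)
qed

text \<open>Finite Szpilrajn theorem: among the finitely many partial orders above \<open>r\<close>
  a maximal one is total, since an incomparable pair could otherwise be added.\<close>

lemma finite_partial_order_extends:
  assumes "finite A" and r: "partial_order_on A r"
  shows "\<exists>L. linear_order_on A L \<and> r \<subseteq> L"
proof -
  define Es where "Es = {s. partial_order_on A s \<and> r \<subseteq> s}"
  have "Es \<subseteq> Pow (A \<times> A)"
    by (auto simp: Es_def order_on_defs)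
  then have "finite Es" by (rule finite_subset) (use \<open>finite A\<close> in auto)
  moreover have "r \<in> Es" using r by (auto simp: Es_def)
  ultimately obtain L where L: "L \<in> Es" "\<forall>s\<in>Es. L \<subseteq> s \<longrightarrow> L = s"
    using finite_has_maximal[of Es] by blast
  then have LE: "partial_order_on A L" "r \<subseteq> L" by (auto simp: Es_def)
  have "total_on A L"
  proof (rule total_onI, rule ccontr)
    fix x y assume xy: "x \<in> A" "y \<in> A" "\<not> ((x, y) \<in> L \<or> (y, x) \<in> L)"
    let ?s = "L \<union> {(a, b). (a, x) \<in> L \<and> (y, b) \<in> L}"
    have s: "partial_order_on A ?s" "(x, y) \<in> ?s"
      by (rule partial_order_on_add_pair[OF LE(1)]; use xy in simp)+
    have "r \<subseteq> ?s" by (rule order_trans[OF LE(2) Un_upper1])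
    with s(1) have "?s \<in> Es" unfolding Es_def by (intro CollectI conjI)
    with L(2) have "L = ?s" by (metis Un_upper1)
    with s(2) show False using xy by metis
  qed
  then show ?thesis using LE by (auto simp: linear_order_on_def)
qed

text \<open>All linear extensions together realize \<open>r\<close>: if \<open>(x, y)\<close> is
  missing from \<open>r\<close>, forcing \<open>y\<close> below \<open>x\<close> before extending
  gives a linear extension without \<open>(x, y)\<close>. Some realizer must exist for the
  \<open>LEAST\<close> in \<open>poset_dim\<close> to be meaningful.\<close>

lemma finite_realizer_exists:
  assumes "finite A" "A \<noteq> {}" and r: "partial_order_on A r"
  shows "\<exists>Ls. finite Ls \<and> (\<forall>L\<in>Ls. linear_order_on A L) \<and> \<Inter>Ls = r"
proof -
  let ?Ls = "{L. linear_order_on A L \<and> r \<subseteq> L}"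
  have sub: "?Ls \<subseteq> Pow (A \<times> A)" by (auto simp: order_on_defs)
  have "\<Inter>?Ls \<subseteq> r"
  proof
    fix z assume z: "z \<in> \<Inter>?Ls"
    obtain x y where zxy [simp]: "z = (x, y)" by (cases z)
    \<comment> \<open>At least one extension exists, so the intersection is not over the empty
      family and \<open>z\<close> lies in \<open>A \<times> A\<close>.\<close>
    obtain L where "linear_order_on A L" "r \<subseteq> L"
      using finite_partial_order_extends[OF \<open>finite A\<close> r] by auto
    then have "(x, y) \<in> L" "L \<subseteq> A \<times> A" using z by (auto simp: order_on_defs)
    then have xy: "x \<in> A" "y \<in> A" by auto
    show "z \<in> r"
    proof (rule ccontr)
      assume "z \<notin> r"
      note ext = partial_order_on_add_pair[OF r xy(2,1)]
      let ?s = "r \<union> {(a, b). (a, y) \<in> r \<and> (x, b) \<in> r}"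
      have s: "partial_order_on A ?s" "(y, x) \<in> ?s" using ext \<open>z \<notin> r\<close> unfolding zxy by blast+
      obtain L where L: "linear_order_on A L" "?s \<subseteq> L"
        using finite_partial_order_extends[OF \<open>finite A\<close> s(1)] by auto
      then have "L \<in> ?Ls" by blast
      then have "(x, y) \<in> L" using z unfolding zxy by blast
      moreover have "(y, x) \<in> L" using L(2) s(2) by (rule subsetD)
      ultimately have "x = y"
        using L(1) by (auto simp: order_on_defs dest: antisymD)
      then show False using \<open>z \<notin> r\<close> xy r by (auto simp: order_on_defs refl_on_def)
    qed
  qed
  then have "\<Inter>?Ls = r" by auto
  moreover have "finite ?Ls"
    by (rule finite_subset[OF sub]) (use \<open>finite A\<close> in auto)
  ultimately show ?thesis by (intro exI[of _ ?Ls]) simp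
qed

lemma poset_dim_realizer:
  assumes "finite A" "A \<noteq> {}" "partial_order_on A r"
  obtains Ls where "finite Ls" "card Ls = poset_dim A r"
    "\<And>L. L \<in> Ls \<Longrightarrow> linear_order_on A L" "\<Inter>Ls = r"
proof -
  let ?P = "\<lambda>k. \<exists>Ls. finite Ls \<and> card Ls = k \<and> (\<forall>L\<in>Ls. linear_order_on A L) \<and> \<Inter>Ls = r"
  have "\<exists>k. ?P k" using finite_realizer_exists[OF assms] by blast
  then have "?P (poset_dim A r)" unfolding poset_dim_def by (rule LeastI_ex)
  then show ?thesis using that by blast
qed

section \<open>The poset of increasing paths\<close>

lemma graph_less_less: "graph_less n E i j \<Longrightarrow> i < j"
proof -
  assume "graph_less n E i j"
  then obtain us where us: "length us \<ge> 2" "hd us = i" "last us = j" "sorted_wrt (<) us"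
    by (auto simp: graph_less_def)
  then obtain a b xs where "us = a # b # xs"
    by (cases us; cases "tl us") auto
  then show ?thesis using us by (auto split: if_splits dest: last_in_set)
qed

text \<open>The two paths are glued at \<open>j\<close>. The result is strictly increasing, so no
  vertex repeats and it is again a path.\<close>

lemma graph_less_trans:
  assumes "graph_less n E i j" "graph_less n E j k"
  shows "graph_less n E i k"
proof -
  obtain us where us: "length us \<ge> 2" "set us \<subseteq> {1..n}" "hd us = i" "last us = j"
      "sorted_wrt (<) us" "distinct us" "successively (\<lambda>u v. {u, v} \<in> E) us"
    using assms(1) by (auto simp: graph_less_def is_path_def)
  obtain vs where vs: "length vs \<ge> 2" "set vs \<subseteq> {1..n}" "hd vs = j" "last vs = k"
      "sorted_wrt (<) vs" "distinct vs" "successively (\<lambda>u v. {u, v} \<in> E) vs"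
    using assms(2) by (auto simp: graph_less_def is_path_def)
  obtain ws where ws: "vs = j # ws" using vs(1,3) by (cases vs) auto
  have wsne: "ws \<noteq> []" using vs(1) ws by auto
  obtain us' where us': "us = us' @ [j]" using us(1,4)
    by (metis append_butlast_last_id list.size(3) not_numeral_le_zero)
  have le: "\<forall>x\<in>set us. x \<le> j" using us(5) by (auto simp: us' sorted_wrt_append)
  have gt: "\<forall>y\<in>set ws. j < y" using vs(5) by (auto simp: ws)
  have s: "sorted_wrt (<) (us @ ws)"
    using us(5) vs(5) le gt by (auto simp: sorted_wrt_append ws intro: le_less_trans)
  then have "distinct (us @ ws)" by (simp add: strict_sorted_iff)
  moreover have "successively (\<lambda>u v. {u, v} \<in> E) (us @ ws)"
    using us(4,7) vs(7) wsne by (cases ws) (auto simp: successively_append_iff ws)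
  ultimately show ?thesis
    unfolding graph_less_def is_path_def
    using s us vs ws wsne by (intro exI[of _ "us @ ws"]) (cases us; force)
qed

lemma graph_less_edge:
  assumes "{u, v} \<in> E" "u < v" "u \<in> {1..n}" "v \<in> {1..n}"
  shows "graph_less n E u v"
  unfolding graph_less_def is_path_def
  using assms by (intro exI[of _ "[u, v]"]) auto

lemma partial_order_graph_poset: "partial_order_on {1..n} (graph_poset n E)"
proof -
  have "trans (graph_poset n E)"
    by (rule transI) (auto simp: graph_poset_def intro: graph_less_trans)
  moreover have "antisym (graph_poset n E)"
    by (rule antisymI) (auto simp: graph_poset_def dest!: graph_less_less)
  ultimately show ?thesis
    by (auto simp: order_on_defs refl_on_def graph_poset_def)
qed

section \<open>The exploration process\<close>

text \<open>\<open>reach E R vs\<close> processes the vertices \<open>vs\<close> in the given order; an increasing list yields the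
  elements above \<open>R\<close> in the poset, a decreasing list those below.\<close>
fun reach :: "'a set set \<Rightarrow> 'a set \<Rightarrow> 'a list \<Rightarrow> 'a set" where
  "reach E R [] = R"
| "reach E R (v # vs) = reach E (if \<exists>u\<in>R. {u, v} \<in> E then insert v R else R) vs"

lemma reach_superset: "R \<subseteq> reach E R vs"
proof (induction vs arbitrary: R)
  case (Cons v vs)
  have "R \<subseteq> (if \<exists>u\<in>R. {u, v} \<in> E then insert v R else R)" by auto
  also note Cons.IH
  finally show ?case by simp
qed simp

lemma reach_subset: "reach E R vs \<subseteq> R \<union> set vs"
proof (induction vs arbitrary: R)
  case (Cons v vs)
  have "reach E R (v # vs) \<subseteq> (if \<exists>u\<in>R. {u, v} \<in> E then insert v R else R) \<union> set vs"
    unfolding reach.simps by (rule Cons.IH)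
  also have "\<dots> \<subseteq> R \<union> set (v # vs)" by auto
  finally show ?case .
qed simp

text \<open>The order \<open>lt\<close> is a parameter so that one lemma serves the upward
  exploration with \<open>(<)\<close> and the downward one with \<open>(>)\<close>. As
  \<open>R\<close> precedes \<open>vs\<close> and \<open>vs\<close> is sorted, every edge that
  triggers an insertion points in the direction in which \<open>S\<close> is closed.\<close>

lemma reach_closed:
  assumes "R \<subseteq> S" "\<And>u v. u \<in> R \<Longrightarrow> v \<in> set vs \<Longrightarrow> lt u v" "sorted_wrt lt vs"
    and "\<And>u v. u \<in> S \<Longrightarrow> v \<in> set vs \<Longrightarrow> lt u v \<Longrightarrow> {u, v} \<in> E \<Longrightarrow> v \<in> S"
  shows "reach E R vs \<subseteq> S"
  using assms
proof (induction vs arbitrary: R)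
  case (Cons v vs)
  let ?R = "if \<exists>u\<in>R. {u, v} \<in> E then insert v R else R"
  have "?R \<subseteq> S"
    using Cons.prems(1,2,4) by (auto; metis insert_iff list.set_intros(1) subsetD)
  moreover have "lt u w" if "u \<in> ?R" "w \<in> set vs" for u w
    using Cons.prems(2)[of u w] Cons.prems(3) that by (auto split: if_splits)
  ultimately show ?case
    unfolding reach.simps using Cons.prems(3,4) by (intro Cons.IH) auto
qed auto

text \<open>When \<open>w\<close> is processed, all smaller vertices have been decided, so a reached
  \<open>u\<close> already belongs to the current set.\<close>

lemma reach_step:
  assumes "sorted_wrt (<) (vs :: nat list)" "\<And>v. v \<in> set vs \<Longrightarrow> v \<notin> R"
    "u \<in> reach E R vs" "w \<in> set vs" "u < w" "\<forall>x\<in>R. x < w" "{u, w} \<in> E"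
  shows "w \<in> reach E R vs"
  using assms
proof (induction vs arbitrary: R)
  case (Cons v vs)
  let ?R = "if \<exists>u\<in>R. {u, v} \<in> E then insert v R else R"
  have u: "u \<in> reach E ?R vs" using Cons.prems(3) by simp
  show ?case
  proof (cases "w = v")
    case True
    \<comment> \<open>All vertices still in the list are at least \<open>w\<close>, while
      \<open>u < w\<close>; hence \<open>u\<close> was reached earlier.\<close>
    have "u \<notin> set (v # vs)" using Cons.prems(1,5) True by auto
    then have "u \<in> R" using Cons.prems(3) reach_subset[of E R "v # vs"] by blast
    then have "w \<in> ?R" using True Cons.prems(7) by auto
    then show ?thesis using reach_superset[of ?R E vs] unfolding reach.simps by blast
  next
    case False
    then have w: "w \<in> set vs" "v < w" using Cons.prems(1,4) by auto
    have "w \<in> reach E ?R vs"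
    proof (rule Cons.IH)
      show "sorted_wrt (<) vs" using Cons.prems(1) by simp
      show "z \<notin> ?R" if "z \<in> set vs" for z
        using Cons.prems(1) Cons.prems(2)[of z] that by auto
      show "\<forall>x\<in>?R. x < w" using Cons.prems(6) w(2) by simp
    qed (use u w Cons.prems in blast)+
    then show ?thesis by simp
  qed
qed auto

text \<open>\<open>reach_step\<close> is applied along the edges of the increasing path. The
  inclusion lets the exploration process bound the number of elements above
  \<open>x\<close>.\<close>

lemma graph_less_reach:
  assumes "graph_less n E x y"
  shows "y \<in> reach E {x} [Suc x..<Suc n]" "x \<in> {1..n}"
proof -
  obtain us where us: "length us \<ge> 2" "set us \<subseteq> {1..n}" "hd us = x" "last us = y"
      "sorted_wrt (<) us" "successively (\<lambda>u v. {u, v} \<in> E) us"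
    using assms by (auto simp: graph_less_def is_path_def)
  then obtain us' where us': "us = x # us'" by (cases us) auto
  show "x \<in> {1..n}" using us(2) unfolding us' by simp
  have sub: "set us \<subseteq> {x..n}"
  proof
    fix u assume u: "u \<in> set us"
    then have "u \<le> n" using us(2) by auto
    moreover have "x \<le> u" using us(5) u unfolding us' by auto
    ultimately show "u \<in> {x..n}" by simp
  qed
  define ws where "ws = [Suc x..<Suc n]"
  have ws: "sorted_wrt (<) ws" "set ws = {Suc x..n}"
    by (auto simp: ws_def sorted_wrt_upt simp del: upt_Suc)
  \<comment> \<open>Stated for any increasing path whose head is already reached, so that the
    induction may drop the first vertex.\<close>
  have *: "last xs \<in> reach E {x} ws"
    if "xs \<noteq> []" "hd xs \<in> reach E {x} ws" "set xs \<subseteq> {x..n}" "sorted_wrt (<) xs"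
      "successively (\<lambda>u v. {u, v} \<in> E) xs" for xs
    using that
  proof (induction xs)
    case (Cons u xs)
    show ?case
    proof (cases xs)
      case Nil
      then show ?thesis using Cons.prems(2) by simp
    next
      case [simp]: (Cons v ys)
      have "v \<in> reach E {x} ws"
      proof (rule reach_step[OF ws(1)])
        show "u \<in> reach E {x} ws" using Cons.prems(2) by simp
        show "v \<in> set ws" "u < v" "{u, v} \<in> E" "\<forall>z\<in>{x}. z < v"
          using Cons.prems(3-5) ws(2) by auto
      qed (use ws(2) in auto)
      then show ?thesis using Cons.IH Cons.prems by simp
    qed
  qed simp
  have "x \<in> reach E {x} ws" using reach_superset[of "{x}" E ws] by simp
  then have "last us \<in> reach E {x} ws"
    by (intro *) (use us sub us' in simp_all)
  then show "y \<in> reach E {x} [Suc x..<Suc n]"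
    unfolding us(4) ws_def .
qed

section \<open>Comparable pairs, and what few linear extensions force\<close>

definition comparable_pairs :: "nat \<Rightarrow> nat set set \<Rightarrow> (nat \<times> nat) set" where
  "comparable_pairs n E = {(x, y). graph_less n E x y}"

lemma comparable_pairs_subset: "comparable_pairs n E \<subseteq> {1..n} \<times> {1..n}"
proof -
  have "x \<in> {1..n} \<and> y \<in> {1..n}" if "graph_less n E x y" for x y
    using that graph_less_reach(1)[OF that] graph_less_reach(2)[OF that]
      reach_subset[of E "{x}" "[Suc x..<Suc n]"] by auto
  then show ?thesis by (auto simp: comparable_pairs_def)
qed

text \<open>Each explored set contains its start \<open>x\<close> as well, so the sum overcounts by
  a linear amount, which is harmless.\<close>

lemma card_comparable_pairs_le:
  "card (comparable_pairs n E) \<le> (\<Sum>x\<in>{1..n}. card (reach E {x} [Suc x..<Suc n]))"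
proof -
  have fin: "finite (reach E {x} [Suc x..<Suc n])" for x
    using reach_subset by (rule finite_subset) auto
  have "comparable_pairs n E \<subseteq> (SIGMA x:{1..n}. reach E {x} [Suc x..<Suc n])"
    using graph_less_reach by (auto simp: comparable_pairs_def)
  then have "card (comparable_pairs n E) \<le> card (SIGMA x:{1..n}. reach E {x} [Suc x..<Suc n])"
    using fin by (intro card_mono) auto
  then show ?thesis using fin by simp
qed

lemma sum_real_upto: "(\<Sum>x\<in>{1..n}. real x) = real n * (real n + 1) / 2"
  by (induction n) (simp_all add: algebra_simps add_divide_distrib)

text \<open>Dimension 1 means that the poset is a chain, in which all \<open>n * (n - 1) / 2\<close>
  pairs are comparable.\<close>

lemma poset_dim_ge_2:
  assumes "n \<ge> 1" "real (card (comparable_pairs n E)) < real n * (real n - 1) / 2"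
  shows "poset_dim {1..n} (graph_poset n E) \<ge> 2"
proof (rule ccontr)
  assume lt2: "\<not> ?thesis"
  obtain Ls where Ls: "finite Ls" "card Ls = poset_dim {1..n} (graph_poset n E)"
    "\<And>L. L \<in> Ls \<Longrightarrow> linear_order_on {1..n} L" "\<Inter>Ls = graph_poset n E"
    by (rule poset_dim_realizer[OF _ _ partial_order_graph_poset[of n E]]) (use assms(1) in auto)
  then have "card Ls = 0 \<or> card Ls = 1" using lt2 Ls(2) by linarith
  moreover have "card Ls \<noteq> 0"
  proof
    assume "card Ls = 0"
    \<comment> \<open>The intersection of the empty family is the full relation, which contains
      pairs outside the carrier.\<close>
    then have "graph_poset n E = UNIV" using Ls by auto
    then have "(0, 0) \<in> graph_poset n E" by simp
    then show False by (simp add: graph_poset_def)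
  qed
  ultimately obtain L where "Ls = {L}" by (auto simp: card_1_singleton_iff)
  then have "linear_order_on {1..n} (graph_poset n E)" using Ls by auto
  then have "total_on {1..n} (graph_poset n E)" by (simp add: linear_order_on_def)
  then have tot: "graph_less n E x y" if "x < y" "x \<in> {1..n}" "y \<in> {1..n}" for x y
    using that graph_less_less[of n E y x] unfolding total_on_def graph_poset_def by fastforce
  have "(SIGMA x:{1..n}. {Suc x..n}) \<subseteq> comparable_pairs n E"
    using tot by (auto simp: comparable_pairs_def)
  then have "card (SIGMA x:{1..n}. {Suc x..n}) \<le> card (comparable_pairs n E)"
    by (intro card_mono finite_subset[OF comparable_pairs_subset]) auto
  moreover have "real (card (SIGMA x:{1..n}. {Suc x..n})) = real n * (real n - 1) / 2"
  proof -
    have "real (card (SIGMA x:{1..n}. {Suc x..n})) = (\<Sum>x\<in>{1..n}. real n - real x)"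
      by (simp add: of_nat_diff)
    also have "\<dots> = real n * real n - (\<Sum>x\<in>{1..n}. real x)"
      by (simp only: sum_subtractf sum_constant card_atLeastAtMost) simp
    also have "\<dots> = real n * (real n - 1) / 2"
      by (simp only: sum_real_upto) (simp add: algebra_simps)
    finally show ?thesis .
  qed
  ultimately show False using assms(2) by linarith
qed

text \<open>The element count \<open>a\<close> bounds both the part of \<open>{1..h}\<close> that \<open>L\<close> places above the cut and the
  closed sets of the exploration, which is why the same number appears in all three hypotheses.\<close>
lemma linear_extension_cut:
  fixes n h m r a :: nat
  assumes mh: "m \<le> h" "h \<le> n - m"
    and sep: "\<And>S T. S \<subseteq> {1..h} \<Longrightarrow> T \<subseteq> {h+1..n} \<Longrightarrow> card S = a \<Longrightarrow> card T = a \<Longrightarrow>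
      \<exists>u\<in>S. \<exists>v\<in>T. {u, v} \<in> E"
    and up: "\<And>R. R \<subseteq> {1..m} \<Longrightarrow> card R = r \<Longrightarrow> a \<le> card (reach E R [Suc m..<Suc h])"
    and down: "\<And>R. R \<subseteq> {n-m+1..n} \<Longrightarrow> card R = r \<Longrightarrow>
      a \<le> card (reach E R (rev [Suc h..<Suc (n-m)]))"
    and L: "linear_order_on {1..n} L" "graph_poset n E \<subseteq> L" and r: "r \<ge> 1"
  obtains H where "\<forall>x\<in>H. \<forall>y\<in>{1..n} - H. (x, y) \<in> L"
    "card ({1..m} - H) \<le> r - 1" "card ({n-m+1..n} \<inter> H) \<le> r - 1"
proof -
  have hn: "h \<le> n" using mh by simp
  obtain H where H: "H \<subseteq> {1..n}" "card H = h" "\<forall>x\<in>H. \<forall>y\<in>{1..n} - H. (x, y) \<in> L"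
    using linear_order_initial_segment[OF L(1), of h] hn by auto
  have finH: "finite H" using H(1) by (rule finite_subset) simp
  define S where "S = {1..h} - H"
  define T where "T = H - {1..h}"
  \<comment> \<open>Both sizes equal \<open>h\<close> minus the size of the common part of
    \<open>H\<close> and \<open>{1..h}\<close>.\<close>
  have TS: "card T = card S"
  proof -
    have "card S + card ({1..h} \<inter> H) = h" "card T + card (H \<inter> {1..h}) = h"
      unfolding S_def T_def
      using card_Diff_subset_Int[of "{1..h}" H] card_Diff_subset_Int[of H "{1..h}"] H(2) finH
        card_mono[of "{1..h}" "{1..h} \<inter> H"] card_mono[of H "H \<inter> {1..h}"]
      by auto
    then show ?thesis by (simp add: Int_commute)
  qed
  have fin: "finite S" "finite T" using finH by (auto simp: S_def T_def)
  have Tsub: "T \<subseteq> {h+1..n}" using H(1) by (auto simp: T_def)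
  have anti: "antisym L" using L(1) by (simp add: order_on_defs)
  \<comment> \<open>The core of the cut: such an edge puts \<open>u\<close> below \<open>v\<close>
    in the poset and hence in \<open>L\<close>, whereas the cut puts \<open>v\<close> before
    \<open>u\<close>.\<close>
  have no_edge: False if "{u, v} \<in> E" "u < v" "u \<in> {1..n}" "v \<in> H" "u \<notin> H" for u v
  proof -
    have "(u, v) \<in> graph_poset n E"
      using graph_less_edge[of u v E n] that H(1) by (auto simp: graph_poset_def)
    then have "(u, v) \<in> L" using L(2) by auto
    moreover have "(v, u) \<in> L" using H(3) that by auto
    ultimately have "u = v" using anti by (simp add: antisymD)
    then show False using that by simp
  qed
  \<comment> \<open>By \<open>no_edge\<close> there is no edge between \<open>S\<close> and
    \<open>T\<close>, so \<open>sep\<close> limits their common size.\<close>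
  have lt_a: "card S < a"
  proof (rule ccontr)
    assume "\<not> card S < a"
    then have *: "a \<le> card S" "a \<le> card T" using TS by auto
    obtain S' where S': "S' \<subseteq> S" "card S' = a" using obtain_subset_with_card_n[OF *(1)] by metis
    obtain T' where T': "T' \<subseteq> T" "card T' = a" using obtain_subset_with_card_n[OF *(2)] by metis
    have "S' \<subseteq> {1..h}" using S'(1) by (auto simp: S_def)
    moreover have "T' \<subseteq> {h+1..n}" using T'(1) Tsub by (rule order_trans)
    ultimately obtain u v where uv: "u \<in> S'" "v \<in> T'" "{u, v} \<in> E"
      using sep S'(2) T'(2) by blast
    have "u \<in> S" "v \<in> T" using uv S' T' by auto
    then show False using no_edge[OF uv(3)] hn Tsub by (auto simp: S_def T_def)
  qed
  have "card ({1..m} - H) \<le> r - 1"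
  proof (rule ccontr)
    assume "\<not> ?thesis"
    then have "r \<le> card ({1..m} - H)" by simp
    then obtain R where R: "R \<subseteq> {1..m} - H" "card R = r"
      using obtain_subset_with_card_n by metis
    \<comment> \<open>\<open>no_edge\<close> also closes \<open>S\<close> under larger neighbours
      within \<open>{1..h}\<close>, so \<open>S\<close> absorbs everything explored from
      \<open>R\<close> and would have at least \<open>a\<close> elements.\<close>
    have "reach E R [Suc m..<Suc h] \<subseteq> S"
    proof (rule reach_closed[where lt = "(<)"])
      show "R \<subseteq> S" using R(1) mh(1) by (auto simp: S_def)
      show "v \<in> S" if "u \<in> S" "v \<in> set [Suc m..<Suc h]" "u < v" "{u, v} \<in> E" for u v
        using no_edge[of u v] that hn by (auto simp: S_def)
    qed (use R(1) in \<open>auto simp: sorted_wrt_upt simp del: upt_Suc\<close>)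
    then have "card (reach E R [Suc m..<Suc h]) \<le> card S" by (rule card_mono[OF fin(1)])
    moreover have "a \<le> card (reach E R [Suc m..<Suc h])" using up[of R] R by blast
    ultimately show False using lt_a by simp
  qed
  moreover have "card ({n-m+1..n} \<inter> H) \<le> r - 1"
  proof (rule ccontr)
    assume "\<not> ?thesis"
    then have "r \<le> card ({n-m+1..n} \<inter> H)" by simp
    then obtain R where R: "R \<subseteq> {n-m+1..n} \<inter> H" "card R = r"
      using obtain_subset_with_card_n by metis
    \<comment> \<open>The dual argument: \<open>T\<close> is closed under smaller neighbours above
      \<open>h\<close>.\<close>
    have "reach E R (rev [Suc h..<Suc (n-m)]) \<subseteq> T"
    proof (rule reach_closed[where lt = "(>)"])
      show "R \<subseteq> T" using R(1) mh by (auto simp: T_def)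
      show "v \<in> T" if "u \<in> T" "v \<in> set (rev [Suc h..<Suc (n-m)])" "v < u" "{u, v} \<in> E" for u v
        using no_edge[of v u] that
        by (cases "v \<le> n") (auto simp: T_def insert_commute simp del: upt_Suc)
      show "sorted_wrt (>) (rev [Suc h..<Suc (n-m)])"
        by (simp add: sorted_wrt_rev sorted_wrt_upt del: upt_Suc)
    qed (use R(1) in \<open>auto simp del: upt_Suc\<close>)
    then have "card (reach E R (rev [Suc h..<Suc (n-m)])) \<le> card T" by (rule card_mono[OF fin(2)])
    moreover have "a \<le> card (reach E R (rev [Suc h..<Suc (n-m)]))" using down[of R] R by blast
    ultimately show False using lt_a TS by simp
  qed
  ultimately show ?thesis using that H(3) by blast
qed

text \<open>Each of the \<open>k\<close> orders of a realizer misplaces at most \<open>r - 1\<close>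
  vertices at either end. The vertices misplaced by none are ordered alike in all of them, hence
  comparable. Truncated subtraction makes the bound trivial once \<open>k * (r - 1)\<close> exceeds
  \<open>m\<close>.\<close>

lemma card_comparable_pairs_ge:
  fixes n h m r a :: nat
  assumes n: "1 \<le> n" and mh: "m \<le> h" "h \<le> n - m"
    and sep: "\<And>S T. S \<subseteq> {1..h} \<Longrightarrow> T \<subseteq> {h+1..n} \<Longrightarrow> card S = a \<Longrightarrow> card T = a \<Longrightarrow>
      \<exists>u\<in>S. \<exists>v\<in>T. {u, v} \<in> E"
    and up: "\<And>R. R \<subseteq> {1..m} \<Longrightarrow> card R = r \<Longrightarrow> a \<le> card (reach E R [Suc m..<Suc h])"
    and down: "\<And>R. R \<subseteq> {n-m+1..n} \<Longrightarrow> card R = r \<Longrightarrow>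
      a \<le> card (reach E R (rev [Suc h..<Suc (n-m)]))"
    and r: "r \<ge> 1"
  defines "k \<equiv> poset_dim {1..n} (graph_poset n E)"
  shows "(m - k * (r - 1))\<^sup>2 \<le> card (comparable_pairs n E)"
proof -
  obtain Ls where Ls: "finite Ls" "card Ls = k"
    "\<And>L. L \<in> Ls \<Longrightarrow> linear_order_on {1..n} L" "\<Inter>Ls = graph_poset n E"
    unfolding k_def
    by (rule poset_dim_realizer[OF _ _ partial_order_graph_poset[of n E]]) (use n in auto)
  have "\<exists>H. (\<forall>x\<in>H. \<forall>y\<in>{1..n} - H. (x, y) \<in> L) \<and>
    card ({1..m} - H) \<le> r - 1 \<and> card ({n-m+1..n} \<inter> H) \<le> r - 1" if "L \<in> Ls" for L
  proof -
    have "graph_poset n E \<subseteq> L" using Ls(4) that by blast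
    show ?thesis
      by (rule linear_extension_cut[OF mh sep up down Ls(3)[OF that] \<open>graph_poset n E \<subseteq> L\<close> r]) blast+
  qed
  then obtain H where H: "\<And>L. L \<in> Ls \<Longrightarrow> \<forall>x\<in>H L. \<forall>y\<in>{1..n} - H L. (x, y) \<in> L"
    "\<And>L. L \<in> Ls \<Longrightarrow> card ({1..m} - H L) \<le> r - 1"
    "\<And>L. L \<in> Ls \<Longrightarrow> card ({n-m+1..n} \<inter> H L) \<le> r - 1"
    by metis
  \<comment> \<open>\<open>A\<close> and \<open>B\<close> are the vertices at the two ends that
    every cut puts on the expected side.\<close>
  define A where "A = {1..m} - (\<Union>L\<in>Ls. {1..m} - H L)"
  define B where "B = {n-m+1..n} - (\<Union>L\<in>Ls. {n-m+1..n} \<inter> H L)"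
  have bound: "card (\<Union>L\<in>Ls. F L) \<le> k * (r - 1)"
    if "\<And>L. L \<in> Ls \<Longrightarrow> card (F L) \<le> r - 1" for F :: "_ \<Rightarrow> nat set"
  proof -
    have "card (\<Union>L\<in>Ls. F L) \<le> (\<Sum>L\<in>Ls. card (F L))" using Ls(1) by (rule card_UN_le)
    also have "\<dots> \<le> (\<Sum>L\<in>Ls. r - 1)" by (rule sum_mono) (rule that)
    finally show ?thesis using Ls(2) by simp
  qed
  have "card {1..m} - card (\<Union>L\<in>Ls. {1..m} - H L) \<le> card A"
    unfolding A_def by (rule diff_card_le_card_Diff) (use Ls(1) in auto)
  then have A: "m - k * (r - 1) \<le> card A"
    using bound[of "\<lambda>L. {1..m} - H L", OF H(2)] by simp
  have "card {n-m+1..n} - card (\<Union>L\<in>Ls. {n-m+1..n} \<inter> H L) \<le> card B"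
    unfolding B_def by (rule diff_card_le_card_Diff) (use Ls(1) in auto)
  then have B: "m - k * (r - 1) \<le> card B"
    using bound[of "\<lambda>L. {n-m+1..n} \<inter> H L", OF H(3)] mh by simp
  have "A \<times> B \<subseteq> comparable_pairs n E"
  proof
    fix z assume "z \<in> A \<times> B"
    then obtain x y where z: "z = (x, y)" "x \<in> A" "y \<in> B" by auto
    have "(x, y) \<in> L" if "L \<in> Ls" for L
      using H(1)[OF that] z that by (auto simp: A_def B_def)
    then have "(x, y) \<in> graph_poset n E" using Ls(4) by auto
    moreover have "x \<noteq> y" using z mh n by (auto simp: A_def B_def)
    ultimately show "z \<in> comparable_pairs n E"
      using z by (auto simp: graph_poset_def comparable_pairs_def)
  qed
  then have "card (A \<times> B) \<le> card (comparable_pairs n E)"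
    by (intro card_mono finite_subset[OF comparable_pairs_subset]) auto
  moreover have "(m - k * (r - 1))\<^sup>2 \<le> card A * card B"
    unfolding power2_eq_square by (rule mult_le_mono[OF A B])
  ultimately show ?thesis by (simp add: card_cartesian_product)
qed

section \<open>Exploring the random graph\<close>

lemma finite_all_edges [simp]: "finite (all_edges n)"
  unfolding all_edges_def by (rule finite_subset[of _ "Pow {1..n}"]) auto

lemma set_pmf_erdos_renyi: "set_pmf (erdos_renyi n p) \<subseteq> Pow (all_edges n)"
  by (auto simp: erdos_renyi_def)

lemma finite_set_pmf_erdos_renyi [simp]: "finite (set_pmf (erdos_renyi n p))"
  using set_pmf_erdos_renyi by (rule finite_subset) simp

lemma integrable_erdos_renyi [simp]: "integrable (erdos_renyi n p) (f :: _ \<Rightarrow> real)"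
  by (rule integrable_measure_pmf_finite) simp

text \<open>The graph is the union of independent random graphs on \<open>A\<close> and on its
  complement \<open>C\<close>. As \<open>B \<subseteq> C\<close>, the predicate \<open>Y\<close>
  depends on the second part only.\<close>

lemma erdos_renyi_indep:
  assumes "A \<inter> B = {}" "A \<subseteq> all_edges n" "B \<subseteq> all_edges n"
  shows "measure_pmf.prob (erdos_renyi n p) {E. X (E \<inter> A) \<and> Y (E \<inter> B)} =
    measure_pmf.prob (erdos_renyi n p) {E. X (E \<inter> A)} *
    measure_pmf.prob (erdos_renyi n p) {E. Y (E \<inter> B)}"
proof -
  define C where "C = all_edges n - A"
  define D where "D G = map_pmf (\<lambda>b. {e \<in> G. b e}) (Pi_pmf G False (\<lambda>_. bernoulli_pmf p))"
    for G :: "nat set set"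
  have fin: "finite A" "finite C"
    using assms(2) by (auto simp: C_def intro: finite_subset)
  have AC: "A \<union> C = all_edges n" "A \<inter> C = {}" using assms(2) by (auto simp: C_def)
  have BC: "B \<subseteq> C" using assms by (auto simp: C_def)
  have er: "erdos_renyi n p = map_pmf (\<lambda>(U, V). U \<union> V) (pair_pmf (D A) (D C))"
    unfolding erdos_renyi_def AC(1)[symmetric] Pi_pmf_union[OF fin AC(2)] D_def
    by (simp add: map_pair[symmetric] map_pmf_comp case_prod_unfold)
       (intro map_pmf_cong refl, use AC(2) in auto)
  have prob: "measure_pmf.prob (erdos_renyi n p) {E. X (E \<inter> A) \<and> Y (E \<inter> B)} =
      measure_pmf.prob (D A) {U \<in> Pow A. X U} * measure_pmf.prob (D C) {V \<in> Pow C. Y (V \<inter> B)}"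
    for X Y
  proof -
    have "measure_pmf.prob (erdos_renyi n p) {E. X (E \<inter> A) \<and> Y (E \<inter> B)} =
      measure_pmf.prob (pair_pmf (D A) (D C))
        {z. X ((fst z \<union> snd z) \<inter> A) \<and> Y ((fst z \<union> snd z) \<inter> B)}"
      unfolding er by (simp add: vimage_def case_prod_unfold)
    also have "\<dots> = measure_pmf.prob (pair_pmf (D A) (D C))
        ({U \<in> Pow A. X U} \<times> {V \<in> Pow C. Y (V \<inter> B)})"
    proof (rule measure_pmf.finite_measure_eq_AE)
      have "(X ((U \<union> V) \<inter> A) \<and> Y ((U \<union> V) \<inter> B)) \<longleftrightarrow> (X U \<and> Y (V \<inter> B))"
        if "U \<subseteq> A" "V \<subseteq> C" for U V
      proof -
        have "(U \<union> V) \<inter> A = U" "(U \<union> V) \<inter> B = V \<inter> B"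
          using that AC(2) BC by auto
        then show ?thesis by simp
      qed
      then show "AE z in pair_pmf (D A) (D C).
        (z \<in> {z. X ((fst z \<union> snd z) \<inter> A) \<and> Y ((fst z \<union> snd z) \<inter> B)}) =
        (z \<in> {U \<in> Pow A. X U} \<times> {V \<in> Pow C. Y (V \<inter> B)})"
        by (auto simp: AE_measure_pmf_iff D_def)
    qed auto
    also have "\<dots> = measure_pmf.prob (D A) {U \<in> Pow A. X U} *
        measure_pmf.prob (D C) {V \<in> Pow C. Y (V \<inter> B)}"
      using fin by (intro measure_pmf_prob_product countable_finite) auto
    finally show ?thesis .
  qed
  have one: "measure_pmf.prob (D G) (Pow G) = 1" for G
    by (rule measure_pmf.prob_eq_1[THEN iffD2]) (auto simp: AE_measure_pmf_iff D_def)
  \<comment> \<open>The three instances of \<open>prob\<close>, two of them with a trivial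
    predicate, give the joint probability and both marginals.\<close>
  show ?thesis
    using prob[of X Y] prob[of X "\<lambda>_. True"] prob[of "\<lambda>_. True" Y] by (simp add: one[unfolded Pow_def])
qed

lemma erdos_renyi_no_edge:
  assumes "A \<subseteq> all_edges n" "0 \<le> p" "p \<le> 1"
  shows "measure_pmf.prob (erdos_renyi n p) {E. E \<inter> A = {}} = (1 - p) ^ card A"
proof -
  let ?B = "\<lambda>e. if e \<in> A then {False} else UNIV"
  have "(\<lambda>b. {e \<in> all_edges n. b e}) -` {E. E \<inter> A = {}} = Pi (all_edges n) ?B"
    using assms(1) by (auto simp: vimage_def Pi_def)
  then have "measure_pmf.prob (erdos_renyi n p) {E. E \<inter> A = {}} =
    measure_pmf.prob (Pi_pmf (all_edges n) False (\<lambda>_. bernoulli_pmf p)) (Pi (all_edges n) ?B)"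
    by (simp add: erdos_renyi_def)
  also have "\<dots> = (\<Prod>e\<in>all_edges n. measure_pmf.prob (bernoulli_pmf p) (?B e))"
    by (rule measure_Pi_pmf_Pi) simp
  also have "\<dots> = (\<Prod>e\<in>all_edges n. if e \<in> A then 1 - p else 1)"
    using assms(2,3) by (intro prod.cong refl) (auto simp: measure_pmf_single)
  also have "\<dots> = (\<Prod>e\<in>A. 1 - p)"
    using assms(1) by (intro prod.mono_neutral_cong_right) auto
  finally show ?thesis by simp
qed

section \<open>The distribution of the explored set\<close>

text \<open>The exploration inspects only pairs with an endpoint in \<open>vs\<close>. This makes
  its outcome a function of an edge set disjoint from the edges used before.\<close>

lemma reach_cong:
  assumes "distinct vs" "R \<inter> set vs = {}"
    "\<And>u v. u \<in> R \<union> set vs \<Longrightarrow> v \<in> set vs \<Longrightarrow> u \<noteq> v \<Longrightarrow> {u, v} \<in> E \<longleftrightarrow> {u, v} \<in> E'"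
  shows "reach E R vs = reach E' R vs"
  using assms
proof (induction vs arbitrary: R)
  case (Cons v vs)
  have "(\<exists>u\<in>R. {u, v} \<in> E) \<longleftrightarrow> (\<exists>u\<in>R. {u, v} \<in> E')"
    using Cons.prems(2,3) by (metis UnI1 disjoint_iff list.set_intros(1))
  moreover have "reach E R' vs = reach E' R' vs" if "R' \<in> {insert v R, R}" for R'
    by (rule Cons.IH) (use Cons.prems that in \<open>simp; blast\<close>)+
  ultimately show ?case by simp
qed simp

text \<open>The first step queries the edges \<open>A\<close> from \<open>R\<close> to
  \<open>v\<close>, the rest only edges in \<open>B\<close>, and these are independent. The
  predicate \<open>\<Phi>\<close> is arbitrary because the recursion is used both for the size and
  for the exact explored set.\<close>

lemma reach_first_step:
  assumes R: "finite R" "R \<inter> set (v # vs) = {}" "distinct (v # vs)" "R \<union> set (v # vs) \<subseteq> {1..n}"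
    and p: "0 \<le> p" "p \<le> 1"
  shows "measure_pmf.prob (erdos_renyi n p) {E. \<Phi> (reach E R (v # vs))} =
    (1 - p) ^ card R * measure_pmf.prob (erdos_renyi n p) {E. \<Phi> (reach E R vs)} +
    (1 - (1 - p) ^ card R) * measure_pmf.prob (erdos_renyi n p) {E. \<Phi> (reach E (insert v R) vs)}"
proof -
  let ?P = "measure_pmf.prob (erdos_renyi n p)"
  define A where "A = (\<lambda>u. {u, v}) ` R"
  define B where "B = {{u, w} | u w. u \<in> insert v R \<union> set vs \<and> w \<in> set vs \<and> u \<noteq> w}"
  \<comment> \<open>Every pair in \<open>B\<close> has an endpoint in \<open>vs\<close>, no pair in
    \<open>A\<close> does.\<close>
  have AB: "A \<inter> B = {}"
  proof -
    have False if "{u, v} = {x, w}" "u \<in> R" "w \<in> set vs" for u x w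
      using that R(2,3) by (auto simp: doubleton_eq_iff)
    then show ?thesis unfolding A_def B_def by blast
  qed
  have pair: "{u, w} \<in> all_edges n" if "u \<in> {1..n}" "w \<in> {1..n}" "u \<noteq> w" for u w
    using that by (simp add: all_edges_def)
  have sub: "A \<subseteq> all_edges n" "B \<subseteq> all_edges n"
    unfolding A_def B_def using R(2,4) by (auto intro!: pair)
  have "inj_on (\<lambda>u. {u, v}) R" by (auto simp: inj_on_def doubleton_eq_iff)
  then have cardA: "card A = card R" unfolding A_def by (rule card_image)
  have edge: "(\<exists>u\<in>R. {u, v} \<in> E) \<longleftrightarrow> E \<inter> A \<noteq> {}" for E by (auto simp: A_def)
  have reachB: "reach (E \<inter> B) R' vs = reach E R' vs" if "R' = R \<or> R' = insert v R" for R' E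
  proof (rule reach_cong)
    fix u w assume uw: "u \<in> R' \<union> set vs" "w \<in> set vs" "u \<noteq> w"
    then have "{u, w} \<in> B" unfolding B_def using that by blast
    then show "{u, w} \<in> E \<inter> B \<longleftrightarrow> {u, w} \<in> E" by simp
  qed (use R that in auto)
  note reachB1 = reachB[OF disjI1[OF refl]] and reachB2 = reachB[OF disjI2[OF refl]]
  have noA: "?P {E. E \<inter> A = {}} = (1 - p) ^ card R"
    using erdos_renyi_no_edge[OF sub(1) p] cardA by simp
  have "?P {E. E \<inter> A \<noteq> {}} = 1 - ?P {E. E \<inter> A = {}}"
    using measure_pmf.prob_compl[of "{E. E \<inter> A = {}}" "erdos_renyi n p"]
    by (simp add: Compl_eq_Diff_UNIV[symmetric] Collect_neg_eq[symmetric])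
  then have someA: "?P {E. E \<inter> A \<noteq> {}} = 1 - (1 - p) ^ card R" using noA by simp
  have "{E. \<Phi> (reach E R (v # vs))} =
      {E. E \<inter> A = {} \<and> \<Phi> (reach (E \<inter> B) R vs)} \<union>
      {E. E \<inter> A \<noteq> {} \<and> \<Phi> (reach (E \<inter> B) (insert v R) vs)}"
    unfolding reachB1 reachB2 using edge by auto
  then have "?P {E. \<Phi> (reach E R (v # vs))} =
      ?P {E. E \<inter> A = {} \<and> \<Phi> (reach (E \<inter> B) R vs)} +
      ?P {E. E \<inter> A \<noteq> {} \<and> \<Phi> (reach (E \<inter> B) (insert v R) vs)}"
    by (simp only:) (rule measure_pmf.finite_measure_Union, auto)
  also have "\<dots> = ?P {E. E \<inter> A = {}} * ?P {E. \<Phi> (reach (E \<inter> B) R vs)} +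
      ?P {E. E \<inter> A \<noteq> {}} * ?P {E. \<Phi> (reach (E \<inter> B) (insert v R) vs)}"
    using erdos_renyi_indep[OF AB sub, of p "\<lambda>F. F = {}" "\<lambda>F. \<Phi> (reach F R vs)"]
      erdos_renyi_indep[OF AB sub, of p "\<lambda>F. F \<noteq> {}" "\<lambda>F. \<Phi> (reach F (insert v R) vs)"]
    by simp
  finally show ?thesis
    unfolding noA someA reachB1 reachB2 .
qed

text \<open>The Gaussian binomial coefficient, given by its q-Pascal rule. Without division,
  nonnegativity and monotonicity in \<open>q\<close> are immediate. For \<open>k < s\<close> the
  truncated exponent multiplies 0.\<close>

fun qbinomial :: "real \<Rightarrow> nat \<Rightarrow> nat \<Rightarrow> real" where
  "qbinomial q k 0 = 1"
| "qbinomial q 0 (Suc s) = 0"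
| "qbinomial q (Suc k) (Suc s) = qbinomial q k (Suc s) + q ^ (k - s) * qbinomial q k s"

lemma qbinomial_eq_0: "k < s \<Longrightarrow> qbinomial q k s = 0"
  by (induction q k s rule: qbinomial.induct) auto

lemma qbinomial_nonneg: "0 \<le> q \<Longrightarrow> 0 \<le> qbinomial q k s"
  by (induction q k s rule: qbinomial.induct) auto

text \<open>A polynomial in \<open>q\<close> with nonnegative coefficients; used to replace
  \<open>1 - p\<close> by \<open>exp (- p)\<close>.\<close>

lemma qbinomial_mono:
  assumes "0 \<le> q" "q \<le> q'"
  shows "qbinomial q k s \<le> qbinomial q' k s"
  using assms
proof (induction q k s rule: qbinomial.induct)
  case (3 q k s)
  have "q ^ (k - s) * qbinomial q k s \<le> q' ^ (k - s) * qbinomial q' k s"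
    using 3 by (intro mult_mono power_mono qbinomial_nonneg) auto
  then show ?case using 3 by simp
qed auto

text \<open>The product formula with denominators cleared, so that \<open>q = 1\<close> and
  \<open>k < s\<close> are covered.\<close>

lemma qbinomial_product:
  "qbinomial q k s * (\<Prod>j<s. 1 - q ^ Suc j) = (\<Prod>i<s. 1 - q ^ (k - i))"
proof (induction q k s rule: qbinomial.induct)
  case (3 q k s)
  define N where "N = (\<Prod>i<s. 1 - q ^ (k - i))"
  have "qbinomial q (Suc k) (Suc s) * (\<Prod>j<Suc s. 1 - q ^ Suc j) =
      qbinomial q k (Suc s) * (\<Prod>j<Suc s. 1 - q ^ Suc j) +
      q ^ (k - s) * (1 - q ^ Suc s) * (qbinomial q k s * (\<Prod>j<s. 1 - q ^ Suc j))"
    by (simp add: algebra_simps)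
  also have "\<dots> = N * (1 - q ^ (k - s)) + q ^ (k - s) * (1 - q ^ Suc s) * N"
    unfolding 3 N_def by simp
  also have "\<dots> = (1 - q ^ Suc k) * N"
  proof (cases "s \<le> k")
    case True
    then have e: "q ^ (k - s) * q ^ Suc s = q ^ Suc k" by (simp flip: power_add)
    have "N * (1 - q ^ (k - s)) + q ^ (k - s) * (1 - q ^ Suc s) * N =
      (1 - q ^ (k - s) * q ^ Suc s) * N" by (simp add: algebra_simps del: power_Suc)
    then show ?thesis unfolding e .
  next
    \<comment> \<open>Here \<open>k < s\<close>, and the factor \<open>i = k\<close> of
      \<open>N\<close> is \<open>1 - q ^ 0 = 0\<close>.\<close>
    case False
    then have "N = 0" unfolding N_def by (intro prod_zero bexI[of _ k]) auto
    then show ?thesis by simp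
  qed
  also have "\<dots> = (\<Prod>i<Suc s. 1 - q ^ (Suc k - i))"
    unfolding prod.lessThan_Suc_shift N_def by simp
  finally show ?case .
qed (auto simp: prod.lessThan_Suc_shift simp del: prod.lessThan_Suc)

text \<open>Put \<open>q = 1 - p\<close>. A hit after \<open>i\<close> earlier ones has probability
  \<open>1 - q ^ (card R + i)\<close>, each missed vertex avoids the original \<open>card R\<close>
  vertices, and avoiding the newly reached ones, summed over the positions of the hits, gives the
  Gaussian binomial. Conditioning on the first vertex reproduces the q-Pascal rule.\<close>

lemma prob_card_reach:
  assumes "finite R" "R \<inter> set vs = {}" "distinct vs" "R \<union> set vs \<subseteq> {1..n}"
    and p: "0 \<le> p" "p \<le> 1"
  shows "measure_pmf.prob (erdos_renyi n p) {E. card (reach E R vs) = card R + s} =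
    (\<Prod>i<s. 1 - (1 - p) ^ (card R + i)) * (1 - p) ^ (card R * (length vs - s)) *
    qbinomial (1 - p) (length vs) s"
  using assms(1-4)
proof (induction vs arbitrary: R s)
  case Nil
  then show ?case by (cases s) auto
next
  case (Cons v vs)
  define q where "q = 1 - p"
  define r where "r = card R"
  define k where "k = length vs"
  let ?P = "measure_pmf.prob (erdos_renyi n p)"
  have vR: "v \<notin> R" using Cons.prems by auto
  then have card_ins: "card (insert v R) = Suc r" using Cons.prems(1) by (simp add: r_def)
  have IH1: "?P {E. card (reach E R vs) = r + s} =
      (\<Prod>i<s. 1 - q ^ (r + i)) * q ^ (r * (k - s)) * qbinomial q k s" for s
    unfolding r_def q_def k_def using Cons.prems by (intro Cons.IH) auto
  have IH2: "?P {E. card (reach E (insert v R) vs) = Suc r + s} =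
      (\<Prod>i<s. 1 - q ^ (Suc r + i)) * q ^ (Suc r * (k - s)) * qbinomial q k s" for s
    unfolding card_ins[symmetric] q_def k_def using Cons.prems by (intro Cons.IH) auto
  have step: "?P {E. card (reach E R (v # vs)) = r + s} =
    q ^ r * ?P {E. card (reach E R vs) = r + s} +
    (1 - q ^ r) * ?P {E. card (reach E (insert v R) vs) = r + s}"
    unfolding r_def q_def
    by (rule reach_first_step[where \<Phi> = "\<lambda>D. card D = card R + s"]) (use Cons.prems p in auto)
  have "?P {E. card (reach E R (v # vs)) = r + s} =
    (\<Prod>i<s. 1 - q ^ (r + i)) * q ^ (r * (Suc k - s)) * qbinomial q (Suc k) s"
  proof (cases s)
    case 0
    \<comment> \<open>Without new vertices the branch that inserts \<open>v\<close> is
      impossible.\<close>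
    have "card (reach E (insert v R) vs) \<noteq> r" for E
    proof -
      have "finite (reach E (insert v R) vs)"
        by (rule finite_subset[OF reach_subset]) (use Cons.prems in auto)
      then have "card (insert v R) \<le> card (reach E (insert v R) vs)"
        by (rule card_mono) (rule reach_superset)
      then show ?thesis using card_ins by simp
    qed
    then have "?P {E. card (reach E (insert v R) vs) = r + s} = 0" using 0 by simp
    then show ?thesis unfolding step IH1 by (simp add: 0 power_add)
  next
    case (Suc t)
    have e: "?P {E. card (reach E (insert v R) vs) = r + s} =
        ?P {E. card (reach E (insert v R) vs) = Suc r + t}" by (simp add: Suc)
    \<comment> \<open>A miss of \<open>v\<close> supplies one more factor \<open>q ^ r\<close>. For
      \<open>k < s\<close> the truncated exponents do not match, but both sides vanish.\<close>
    have a: "q ^ r * ((\<Prod>i<s. 1 - q ^ (r + i)) * q ^ (r * (k - s)) * qbinomial q k s) =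
        (\<Prod>i<s. 1 - q ^ (r + i)) * q ^ (r * (k - t)) * qbinomial q k s"
    proof (cases "k < s")
      case True
      then show ?thesis by (simp add: qbinomial_eq_0)
    next
      case False
      then have "k - t = Suc (k - s)" using Suc by simp
      then have "q ^ (r * (k - t)) = q ^ r * q ^ (r * (k - s))" by (simp add: power_add)
      then show ?thesis by simp
    qed
    have b: "(1 - q ^ r) * ((\<Prod>i<t. 1 - q ^ (Suc r + i)) * q ^ (Suc r * (k - t)) * qbinomial q k t)
        = (\<Prod>i<s. 1 - q ^ (r + i)) * q ^ (r * (k - t)) * (q ^ (k - t) * qbinomial q k t)"
    proof -
      have "(\<Prod>i<s. 1 - q ^ (r + i)) = (1 - q ^ r) * (\<Prod>i<t. 1 - q ^ (Suc r + i))"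
        unfolding Suc prod.lessThan_Suc_shift by simp
      moreover have "q ^ (Suc r * (k - t)) = q ^ (r * (k - t)) * q ^ (k - t)"
        by (simp add: power_add)
      ultimately show ?thesis by (simp only: mult_ac)
    qed
    have "qbinomial q (Suc k) s = qbinomial q k s + q ^ (k - t) * qbinomial q k t"
      "Suc k - s = k - t" by (simp_all add: Suc)
    then show ?thesis
      unfolding step e IH1 IH2 a b by (simp only: distrib_left)
  qed
  then show ?case by (simp only: q_def r_def k_def list.size(4) add_Suc_right add_0_right) 
qed

section \<open>The expected number of comparable pairs\<close>

text \<open>As a finite sum over the values \<open>D\<close>, the expectation inherits the recursion
  of \<open>reach_first_step\<close>.\<close>

lemma expectation_reach_eq:
  assumes "R \<union> set vs \<subseteq> {1..n}"
  shows "measure_pmf.expectation (erdos_renyi n p) (\<lambda>E. real (card (reach E R vs))) =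
    (\<Sum>D\<in>Pow {1..n}. measure_pmf.prob (erdos_renyi n p) {E. reach E R vs = D} * real (card D))"
proof -
  let ?M = "map_pmf (\<lambda>E. reach E R vs) (erdos_renyi n p)"
  have "measure_pmf.expectation (erdos_renyi n p) (\<lambda>E. real (card (reach E R vs))) =
    measure_pmf.expectation ?M (\<lambda>D. real (card D))" by simp
  also have "\<dots> = (\<Sum>D\<in>Pow {1..n}. pmf ?M D *\<^sub>R real (card D))"
    using assms reach_subset[of _ R vs] by (intro integral_measure_pmf) auto
  finally show ?thesis by (simp add: pmf_map vimage_def)
qed

text \<open>By Bernoulli's inequality the next vertex is reached with probability at most
  \<open>p * card R\<close>, so each vertex multiplies the expected size by at most
  \<open>1 + p\<close>.\<close>

lemma expectation_card_reach_le:
  assumes "finite R" "R \<inter> set vs = {}" "distinct vs" "R \<union> set vs \<subseteq> {1..n}"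
    and p: "0 \<le> p" "p \<le> 1"
  shows "measure_pmf.expectation (erdos_renyi n p) (\<lambda>E. real (card (reach E R vs)))
    \<le> real (card R) * (1 + p) ^ length vs"
  using assms(1-4)
proof (induction vs arbitrary: R)
  case (Cons v vs)
  define q where "q = (1 - p) ^ card R"
  have q: "0 \<le> q" "q \<le> 1" using p by (auto simp: q_def power_le_one)
  let ?P = "measure_pmf.prob (erdos_renyi n p)"
  let ?Ex = "\<lambda>R vs. measure_pmf.expectation (erdos_renyi n p) (\<lambda>E. real (card (reach E R vs)))"
  have "?P {E. reach E R (v # vs) = D} =
    q * ?P {E. reach E R vs = D} + (1 - q) * ?P {E. reach E (insert v R) vs = D}" for D
    unfolding q_def by (rule reach_first_step) (use Cons.prems p in auto)
  then have "?Ex R (v # vs) = q * ?Ex R vs + (1 - q) * ?Ex (insert v R) vs"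
    using Cons.prems
    by (subst (1 2 3) expectation_reach_eq)
       (auto simp: sum_distrib_left sum.distrib[symmetric] distrib_right mult.assoc)
  also have "\<dots> \<le> q * (real (card R) * (1 + p) ^ length vs) +
      (1 - q) * (real (card (insert v R)) * (1 + p) ^ length vs)"
    using Cons.prems q by (intro add_mono mult_left_mono Cons.IH) auto
  also have "\<dots> = (real (card R) + (1 - q)) * (1 + p) ^ length vs"
    using Cons.prems by (simp add: algebra_simps)
  also have "\<dots> \<le> (real (card R) * (1 + p)) * (1 + p) ^ length vs"
  proof (rule mult_right_mono)
    have "1 + real (card R) * (- p) \<le> (1 + (- p)) ^ card R"
      by (rule Bernoulli_inequality) (use p in simp)
    then show "real (card R) + (1 - q) \<le> real (card R) * (1 + p)"
      by (simp add: q_def algebra_simps)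
  qed (use p in simp)
  finally show ?case by (simp add: mult.assoc)
qed simp

lemma prob_many_comparable_pairs:
  assumes "0 \<le> p" "p \<le> 1" "x > 0"
  shows "measure_pmf.prob (erdos_renyi n p) {E. x \<le> real (card (comparable_pairs n E))}
    \<le> real n * (1 + p) ^ n / x"
proof -
  let ?M = "erdos_renyi n p"
  have "measure_pmf.expectation ?M (\<lambda>E. real (card (comparable_pairs n E))) \<le>
    measure_pmf.expectation ?M (\<lambda>E. \<Sum>x\<in>{1..n}. real (card (reach E {x} [Suc x..<Suc n])))"
    using card_comparable_pairs_le[of n]
    by (intro integral_mono) (auto simp del: upt_Suc simp flip: of_nat_sum)
  also have "\<dots> = (\<Sum>x\<in>{1..n}. measure_pmf.expectation ?M
      (\<lambda>E. real (card (reach E {x} [Suc x..<Suc n]))))"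
    by (rule Bochner_Integration.integral_sum) simp
  also have "\<dots> \<le> (\<Sum>x\<in>{1..n}. (1 + p) ^ n)"
  proof (rule sum_mono)
    fix x assume x: "x \<in> {1..n}"
    have "measure_pmf.expectation ?M (\<lambda>E. real (card (reach E {x} [Suc x..<Suc n])))
      \<le> real (card {x}) * (1 + p) ^ length [Suc x..<Suc n]"
      using assms x by (intro expectation_card_reach_le) (auto simp del: upt_Suc)
    also have "\<dots> \<le> (1 + p) ^ n"
      using assms by (auto simp del: upt_Suc intro!: power_increasing)
    finally show "measure_pmf.expectation ?M (\<lambda>E. real (card (reach E {x} [Suc x..<Suc n])))
      \<le> (1 + p) ^ n" .
  qed
  finally have *: "measure_pmf.expectation ?M (\<lambda>E. real (card (comparable_pairs n E)))
      \<le> real n * (1 + p) ^ n" by simp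
  have "measure_pmf.prob ?M {E \<in> space ?M. x \<le> real (card (comparable_pairs n E))}
    \<le> measure_pmf.expectation ?M (\<lambda>E. real (card (comparable_pairs n E))) / x"
    by (rule integral_Markov_inequality_measure[where A = "{}"]) (use assms in auto)
  also have "\<dots> \<le> real n * (1 + p) ^ n / x"
    using * assms by (intro divide_right_mono) auto
  finally show ?thesis by simp
qed

section \<open>The rate function\<close>

text \<open>The dominating function has the antiderivative \<open>2 * y - 8 * sqrt (1 - y)\<close>, which is continuous
  up to the singularity at 1.\<close>
lemma dilog_integrable: "(\<lambda>y::real. ln (1 - y) / y) integrable_on {0..1}"
proof (rule measurable_bounded_by_integrable_imp_integrable)
  show "(\<lambda>y::real. ln (1 - y) / y) \<in> borel_measurable (lebesgue_on {0..1})"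
    by (rule borel_measurable_if_D, rule measurable_completion) measurable
  have "((\<lambda>y::real. 2 + 4 / sqrt (1 - y)) has_integral
      ((2 * 1 - 8 * sqrt (1 - 1)) - (2 * 0 - 8 * sqrt (1 - 0)))) {0..1}"
  proof (rule fundamental_theorem_of_calculus_interior)
    show "continuous_on {0..1} (\<lambda>y::real. 2 * y - 8 * sqrt (1 - y))"
      by (intro continuous_intros)
    show "((\<lambda>y. 2 * y - 8 * sqrt (1 - y)) has_vector_derivative 2 + 4 / sqrt (1 - y)) (at y)"
      if "y \<in> {0<..<1}" for y :: real
      unfolding has_real_derivative_iff_has_vector_derivative[symmetric]
      using that by (auto intro!: derivative_eq_intros simp: field_simps)
  qed simp
  then show "(\<lambda>y::real. 2 + 4 / sqrt (1 - y)) integrable_on {0..1}"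
    by (rule has_integral_integrable)
  show "norm (ln (1 - y) / y) \<le> 2 + 4 / sqrt (1 - y)" if "y \<in> {0..1}" for y :: real
  proof (cases "0 < y \<and> y < 1")
    case True
    \<comment> \<open>Up to 1/2 the constant 2 suffices; beyond 1/2 the square root term dominates
      the logarithm.\<close>
    have "- ln (1 - y) \<le> y * (2 + 4 / sqrt (1 - y))"
    proof (cases "y \<le> 1/2")
      case half: True
      have "- ln (1 - y) = ln (1 / (1 - y))" using True by (simp add: ln_div)
      also have "\<dots> \<le> 1 / (1 - y) - 1" using True by (intro ln_le_minus_one) auto
      also have "\<dots> = y / (1 - y)" using True by (simp add: field_simps)
      also have "\<dots> \<le> y / (1/2)" using True half by (intro divide_left_mono) auto
      also have "\<dots> = y * 2" by simp
      also have "\<dots> \<le> y * (2 + 4 / sqrt (1 - y))" using True by (intro mult_left_mono) auto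
      finally show ?thesis .
    next
      case False
      have "- ln (1 - y) = 2 * ln (1 / sqrt (1 - y))"
        using True by (simp add: ln_div ln_sqrt)
      also have "\<dots> \<le> 2 * (1 / sqrt (1 - y) - 1)"
        using True by (intro mult_left_mono ln_le_minus_one) auto
      also have "\<dots> \<le> 1/2 * (4 / sqrt (1 - y))" by simp
      also have "\<dots> \<le> y * (2 + 4 / sqrt (1 - y))"
        using True False by (intro mult_mono) auto
      finally show ?thesis .
    qed
    moreover have "ln (1 - y) \<le> 0" using True by simp
    ultimately show ?thesis using True by (simp add: field_simps)
  next
    case False
    \<comment> \<open>At the endpoints the integrand has the default value 0.\<close>
    then have "y = 0 \<or> y = 1" using that by auto
    then show ?thesis by auto
  qed
qed simp

lemma continuous_on_Li2: "continuous_on {0..1} Li2"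
  unfolding Li2_def
  by (intro continuous_on_minus indefinite_integral_continuous_1 dilog_integrable)

lemma has_real_derivative_Li2:
  assumes "0 < z" "z < 1"
  shows "(Li2 has_real_derivative - ln (1 - z) / z) (at z)"
proof -
  have "continuous (at z) (\<lambda>y. ln (1 - y) / y)"
    using assms by (intro continuous_intros) auto
  then have "continuous (at z within {0..1} - {}) (\<lambda>y. ln (1 - y) / y)"
    by (rule continuous_at_imp_continuous_at_within)
  then have "((\<lambda>u. integral {0..u} (\<lambda>y. ln (1 - y) / y)) has_vector_derivative
      ln (1 - z) / z) (at z within {0..1} - {})"
    by (rule integral_has_vector_derivative_continuous_at[OF dilog_integrable, rotated 2])
       (use assms in auto)
  moreover have "at z within {0..1} = at z"
    using assms by (intro at_within_Icc_at) auto
  ultimately have "((\<lambda>u. integral {0..u} (\<lambda>y. ln (1 - y) / y)) has_real_derivative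
      ln (1 - z) / z) (at z)"
    unfolding has_real_derivative_iff_has_vector_derivative by simp
  from DERIV_minus[OF this] show ?thesis
    unfolding Li2_def by simp
qed

section \<open>Exponential rates and their antiderivative\<close>

text \<open>The limiting cost, minus the logarithm of the probability, of a vertex having a
  neighbour among \<open>x * n\<close> given vertices when \<open>p = c / n\<close>.\<close>

definition edge_rate :: "real \<Rightarrow> real \<Rightarrow> real" where
  "edge_rate c x = - ln (1 - exp (- c * x))"

text \<open>The integral of \<open>edge_rate c\<close> from 0 to \<open>x\<close> in closed form. It
  is finite although the integrand has a logarithmic singularity at 0.\<close>

definition edge_rate_integral :: "real \<Rightarrow> real \<Rightarrow> real" where
  "edge_rate_integral c x = (Li2 1 - Li2 (exp (- c * x))) / c"

lemma edge_rate_nonneg: "c > 0 \<Longrightarrow> x > 0 \<Longrightarrow> 0 \<le> edge_rate c x"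
  unfolding edge_rate_def by (simp add: mult_pos_pos)

lemma edge_rate_antimono:
  assumes "c > 0" "0 < x" "x \<le> y"
  shows "edge_rate c y \<le> edge_rate c x"
proof -
  have "exp (- c * x) < 1" using assms by simp
  moreover have "exp (- c * y) \<le> exp (- c * x)" using assms by simp
  ultimately show ?thesis unfolding edge_rate_def by (simp add: ln_mono)
qed

lemma exp_minus_edge_rate:
  assumes "c > 0" "x > 0"
  shows "exp (- edge_rate c x) = 1 - exp (- c * x)"
  using assms by (simp add: edge_rate_def)

lemma edge_rate_integral_0 [simp]: "edge_rate_integral c 0 = 0"
  by (simp add: edge_rate_integral_def)

lemma has_real_derivative_edge_rate_integral:
  assumes "c > 0" "x > 0"
  shows "(edge_rate_integral c has_real_derivative edge_rate c x) (at x)"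
proof -
  have e: "exp (- c * x) < 1" using assms by simp
  have "((\<lambda>x. Li2 (exp (- c * x))) has_real_derivative
      - ln (1 - exp (- c * x)) / exp (- c * x) * (exp (- c * x) * - c)) (at x)"
    by (rule DERIV_chain2[OF has_real_derivative_Li2])
       (use e in \<open>auto intro!: derivative_eq_intros\<close>)
  then have "((\<lambda>x. (Li2 1 - Li2 (exp (- c * x))) / c) has_real_derivative
      (0 - (- ln (1 - exp (- c * x)) / exp (- c * x) * (exp (- c * x) * - c))) / c) (at x)"
    by (intro DERIV_cdivide DERIV_diff DERIV_const)
  then show ?thesis
    unfolding edge_rate_integral_def edge_rate_def using assms by simp
qed

lemma continuous_on_edge_rate_integral:
  assumes "c > 0"
  shows "continuous_on {0..} (edge_rate_integral c)"
  unfolding edge_rate_integral_def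
  by (intro continuous_intros continuous_on_compose2[OF continuous_on_Li2])
     (use assms in \<open>auto simp: mult_nonneg_nonneg\<close>)

text \<open>The left end may be 0, where only continuity is available; the derivative enters at
  interior points.\<close>

lemma edge_rate_integral_mvt:
  assumes "c > 0" "0 \<le> x" "x < y"
  obtains z where "x < z" "z < y"
    "edge_rate_integral c y - edge_rate_integral c x = edge_rate c z * (y - x)"
proof -
  have "continuous_on {x..y} (edge_rate_integral c)"
    by (rule continuous_on_subset[OF continuous_on_edge_rate_integral]) (use assms in auto)
  moreover have "(edge_rate_integral c has_derivative (*) (edge_rate c z)) (at z)"
    if "x < z" "z < y" for z
    using has_real_derivative_edge_rate_integral[of c z] assms that
    by (simp add: has_field_derivative_def)
  ultimately show ?thesis
    using mvt[OF assms(3), of "edge_rate_integral c" "\<lambda>z. (*) (edge_rate c z)"] that by blast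
qed

lemma edge_rate_integral_diff_ge:
  assumes "c > 0" "0 \<le> x" "x \<le> y"
  shows "edge_rate c y * (y - x) \<le> edge_rate_integral c y - edge_rate_integral c x"
proof (cases "x = y")
  case False
  then obtain z where z: "x < z" "z < y"
    "edge_rate_integral c y - edge_rate_integral c x = edge_rate c z * (y - x)"
    using edge_rate_integral_mvt[of c x y] assms by auto
  then show ?thesis
    using assms edge_rate_antimono[of c z y] by (simp add: mult_right_mono)
qed simp

lemma edge_rate_integral_diff_le:
  assumes "c > 0" "0 < x" "x \<le> y"
  shows "edge_rate_integral c y - edge_rate_integral c x \<le> edge_rate c x * (y - x)"
proof (cases "x = y")
  case False
  then obtain z where z: "x < z" "z < y"
    "edge_rate_integral c y - edge_rate_integral c x = edge_rate c z * (y - x)"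
    using edge_rate_integral_mvt[of c x y] assms by auto
  then show ?thesis
    using assms edge_rate_antimono[of c x z] by (simp add: mult_right_mono)
qed simp

lemma edge_rate_integral_mono:
  assumes "c > 0" "0 \<le> x" "x \<le> y"
  shows "edge_rate_integral c x \<le> edge_rate_integral c y"
proof (cases "y = 0")
  case False
  then have "0 \<le> edge_rate c y * (y - x)"
    using assms by (intro mult_nonneg_nonneg edge_rate_nonneg) auto
  then show ?thesis using edge_rate_integral_diff_ge[OF assms] by simp
qed (use assms in auto)

text \<open>Each dilogarithm difference is a difference of antiderivatives of
  \<open>edge_rate\<close>, which is the form in which the product estimates arrive.\<close>

lemma dim_rate_eq:
  "dim_rate c \<xi> \<beta> t = \<beta> * ln (exp 1 * \<xi> / \<beta>) - c * \<beta> * (1/2 - \<xi> - t)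
    + edge_rate_integral c t - (edge_rate_integral c (\<beta> + t) - edge_rate_integral c \<beta>)
    - (edge_rate_integral c (1/2 - \<xi>) - edge_rate_integral c (1/2 - \<xi> - t))"
proof -
  have "- c * \<beta> - c * t = - c * (\<beta> + t)"
    "- c * (1/2 - \<xi> - t) - c * t = - c * (1/2 - \<xi>)" by (simp_all add: algebra_simps)
  then show ?thesis
    unfolding dim_rate_def edge_rate_integral_def
    by (simp add: add_divide_distrib diff_divide_distrib)
qed

text \<open>Yields boundedness on \<open>{0..a}\<close>, so that the \<open>SUP\<close> in the
  hypothesis really bounds every value.\<close>

lemma continuous_on_dim_rate:
  assumes "c > 0" "\<beta> > 0" "\<xi> + a \<le> 1/2"
  shows "continuous_on {0..a} (dim_rate c \<xi> \<beta>)"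
proof -
  note cont = continuous_on_compose2[OF continuous_on_edge_rate_integral[OF assms(1)]]
  show ?thesis
    unfolding dim_rate_eq using assms
    by (intro continuous_intros cont) auto
qed

text \<open>A right Riemann sum of a decreasing function lies below the integral.\<close>

lemma sum_edge_rate_le:
  assumes "c > 0" "n > 0"
  shows "(\<Sum>j<s. edge_rate c (real (Suc j) / n)) \<le> n * edge_rate_integral c (real s / n)"
proof (induction s)
  case (Suc s)
  have "edge_rate c (real (Suc s) / n) = n * (edge_rate c (real (Suc s) / n) *
      (real (Suc s) / n - real s / n))"
    using assms by (simp add: field_simps)
  also have "\<dots> \<le> n * (edge_rate_integral c (real (Suc s) / n) - edge_rate_integral c (real s / n))"
    using assms by (intro mult_left_mono edge_rate_integral_diff_ge divide_right_mono) auto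
  finally show ?case using Suc by (simp add: algebra_simps)
qed simp

text \<open>A left Riemann sum of a decreasing function lies above the integral; it starts at
  \<open>x > 0\<close>, away from the singularity.\<close>

lemma sum_edge_rate_ge:
  assumes "c > 0" "n > 0" "x > 0"
  shows "n * (edge_rate_integral c ((x + real s) / n) - edge_rate_integral c (x / n))
    \<le> (\<Sum>i<s. edge_rate c ((x + real i) / n))"
proof (induction s)
  case (Suc s)
  have "n * (edge_rate_integral c ((x + real (Suc s)) / n) - edge_rate_integral c ((x + real s) / n))
    \<le> n * (edge_rate c ((x + real s) / n) * ((x + real (Suc s)) / n - (x + real s) / n))"
    using assms by (intro mult_left_mono edge_rate_integral_diff_le divide_right_mono) auto
  also have "\<dots> = edge_rate c ((x + real s) / n)"
    using assms by (simp add: field_simps)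
  finally show ?case using Suc by (simp add: algebra_simps)
qed simp

lemma alpha_log_form:
  fixes c x :: real
  assumes "x > 0"
  shows "exp 2 / x\<^sup>2 * exp (- c * x) = exp (2 - 2 * ln x - c * x)"
proof -
  have "exp (2 * ln x) = x\<^sup>2"
    using assms by (metis exp_double exp_ln)
  then show ?thesis by (simp add: exp_diff exp_minus exp_add field_simps)
qed

text \<open>In logarithmic form the equation reads \<open>G x = 0\<close> with \<open>G\<close>
  strictly increasing, so the \<open>THE\<close> is well defined and the sign of \<open>G\<close>
  decides on which side of the root \<open>x\<close> lies.\<close>

lemma alpha_properties:
  assumes c: "c > 0"
  shows "alpha c > 0" "exp 2 / (alpha c)\<^sup>2 * exp (- c * alpha c) = 1"
    and "\<And>x. x > 0 \<Longrightarrow> exp 2 / x\<^sup>2 * exp (- c * x) < 1 \<longleftrightarrow> alpha c < x"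
proof -
  define G where "G x = 2 * ln x + c * x - 2" for x :: real
  have mono: "G x < G y" if "0 < x" "x < y" for x y
    unfolding G_def using that c by (intro diff_strict_right_mono add_strict_mono mult_strict_left_mono) auto
  have F: "exp 2 / x\<^sup>2 * exp (- c * x) = exp (- G x)" if "x > 0" for x
    using alpha_log_form[OF that, of c] by (simp add: G_def algebra_simps)
  \<comment> \<open>Chosen so that \<open>ln l \<le> 0\<close> and \<open>c * l < 1\<close>, hence
    \<open>G l \<le> 0\<close>; at the other end \<open>G (exp 1) = c * exp 1\<close>.\<close>
  define l where "l = 1 / (1 + c)"
  have "l \<le> 1" using c by (simp add: l_def)
  also have "\<dots> \<le> exp 1" by simp
  finally have "l \<le> exp 1" .
  then have l: "l \<le> exp 1" "0 < l" "c * l < 1" "ln l \<le> 0"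
    using c by (simp_all add: l_def ln_div field_simps)
  have "G l \<le> 0" unfolding G_def using l(3,4) by linarith
  moreover have "0 \<le> G (exp 1)" using c by (simp add: G_def)
  moreover have "continuous_on {l..exp 1} G"
    unfolding G_def using l by (intro continuous_intros) auto
  ultimately obtain x0 where x0: "l \<le> x0" "G x0 = 0"
    using IVT'[of G l 0 "exp 1"] l by auto
  have ex1: "\<exists>!x. x > 0 \<and> exp 2 / x\<^sup>2 * exp (- c * x) = 1"
  proof (rule ex1I[of _ x0])
    show "x0 > 0 \<and> exp 2 / x0\<^sup>2 * exp (- c * x0) = 1" using x0 l F[of x0] by simp
    fix y assume y: "y > 0 \<and> exp 2 / y\<^sup>2 * exp (- c * y) = 1"
    then have "G y = 0" using F[of y] by simp
    then show "y = x0" using mono[of x0 y] mono[of y x0] x0 l y by (cases x0 y rule: linorder_cases) auto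
  qed
  have a: "alpha c > 0 \<and> exp 2 / (alpha c)\<^sup>2 * exp (- c * alpha c) = 1"
    unfolding alpha_def by (rule theI'[OF ex1])
  then show "alpha c > 0" "exp 2 / (alpha c)\<^sup>2 * exp (- c * alpha c) = 1" by auto
  have Ga: "G (alpha c) = 0" using a F[of "alpha c"] by simp
  show "exp 2 / x\<^sup>2 * exp (- c * x) < 1 \<longleftrightarrow> alpha c < x" if "x > 0" for x
    unfolding F[OF that] using mono[of x "alpha c"] mono[of "alpha c" x] Ga a that
    by (cases x "alpha c" rule: linorder_cases) auto
qed

section \<open>Elementary estimates\<close>

lemma power_over_fact_le_exp:
  fixes x :: real
  assumes "x \<ge> 0"
  shows "x ^ k / fact k \<le> exp x"
proof -
  have "(\<Sum>i\<in>{k}. x ^ i /\<^sub>R fact i) \<le> (\<Sum>i. x ^ i /\<^sub>R fact i)"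
    by (rule sum_le_suminf[OF summable_exp_generic]) (use assms in auto)
  then show ?thesis by (simp add: exp_def divide_inverse mult.commute)
qed

text \<open>Combines \<open>n ^ k / fact k\<close> with \<open>fact k \<ge> (k / e) ^ k\<close>, the
  latter from a single term of the exponential series.\<close>

lemma binomial_le_exp_power:
  assumes "k \<ge> 1"
  shows "real (n choose k) \<le> (exp 1 * real n / real k) ^ k"
proof -
  have "real (n choose k) * fact k \<le> real n ^ k"
    using binomial_fact_pow[of n k] by (metis of_nat_fact of_nat_le_iff of_nat_mult of_nat_power)
  then have "real (n choose k) \<le> real n ^ k / fact k" by (simp add: field_simps)
  also have "\<dots> \<le> real n ^ k * (exp (real k) / real k ^ k)"
  proof -
    have "real k ^ k / fact k \<le> exp (real k)" by (rule power_over_fact_le_exp) simp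
    then have "1 / fact k \<le> exp (real k) / real k ^ k"
      using assms by (simp add: field_simps)
    then have "real n ^ k * (1 / fact k) \<le> real n ^ k * (exp (real k) / real k ^ k)"
      by (rule mult_left_mono) simp
    then show ?thesis by simp
  qed
  also have "\<dots> = (exp 1 * real n / real k) ^ k"
    by (simp add: power_divide power_mult_distrib exp_of_nat_mult[symmetric])
  finally show ?thesis .
qed

text \<open>Bernoulli's inequality for the exponent \<open>1 + d\<close> and the base
  \<open>exp (- y)\<close>.\<close>

lemma one_minus_exp_le:
  fixes d y :: real
  assumes "0 \<le> d"
  shows "1 - exp (- (1 + d) * y) \<le> (1 + d) * (1 - exp (- y))"
proof -
  have "exp (- y) * (1 + y) \<le> exp (- y) * exp y"
    by (intro mult_left_mono exp_ge_add_one_self) simp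
  then have "exp (- y) * (1 + y) \<le> 1" by (simp flip: exp_add)
  then have "d * (exp (- y) * (1 + y)) \<le> d * 1" using assms by (rule mult_left_mono)
  moreover have "exp (- y) * (1 - d * y) \<le> exp (- y) * exp (- d * y)"
    using exp_ge_add_one_self[of "- d * y"] by (intro mult_left_mono) auto
  moreover have "exp (- y) * exp (- d * y) = exp (- (1 + d) * y)"
    by (simp flip: exp_add add: algebra_simps)
  ultimately show ?thesis by (simp add: algebra_simps)
qed

text \<open>For an upper bound here \<open>1 - p \<le> exp (- p)\<close> points the wrong way. The
  correction \<open>1 + 2 * p\<close> comes from \<open>ln (1 - p) \<ge> - p - 2 * p^2\<close>; over
  at most \<open>n\<close> vertices it costs only a constant factor.\<close>

lemma one_minus_power_le:
  fixes p :: real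
  assumes "0 \<le> p" "p \<le> 1/2"
  shows "1 - (1 - p) ^ j \<le> (1 + 2 * p) * (1 - exp (- p) ^ j)"
proof -
  have "- (1 + 2 * p) * p \<le> ln (1 - p)"
    using ln_one_minus_pos_lower_bound[OF assms] by (simp add: algebra_simps power2_eq_square)
  then have "exp (- (1 + 2 * p) * p) \<le> exp (ln (1 - p))" by simp
  also have "\<dots> = 1 - p" using assms by simp
  finally have "exp (- (1 + 2 * p) * p) \<le> 1 - p" .
  then have "exp (- (1 + 2 * p) * p) ^ j \<le> (1 - p) ^ j" by (rule power_mono) simp
  moreover have "exp (- (1 + 2 * p) * p) ^ j = exp (- (1 + 2 * p) * (p * real j))"
    by (simp flip: exp_of_nat_mult add: algebra_simps)
  moreover have "exp (- p) ^ j = exp (- (p * real j))"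
    by (simp flip: exp_of_nat_mult add: algebra_simps)
  ultimately show ?thesis
    using one_minus_exp_le[of "2 * p" "p * real j"] assms by simp
qed

section \<open>Negativity of the rate for large \<open>c\<close>\<close>

text \<open>Compares \<open>edge_rate c x \<le> ln (2 / (c * b)) + ln (b / x)\<close> with
  \<open>ln (b / x) \<le> 2 * sqrt (b / x)\<close>, which has an elementary antiderivative.\<close>
lemma edge_rate_integral_le:
  assumes "c > 0" "0 < b" "c * b \<le> 1"
  shows "edge_rate_integral c b \<le> b * ln (2 / (c * b)) + 4 * b"
proof -
  \<comment> \<open>\<open>H\<close> is an antiderivative of the majorant \<open>D\<close>, so it
    suffices to show \<open>edge_rate c x \<le> D x\<close> inside the interval.\<close>
  define H where "H x = x * ln (2 / (c * b)) + 4 * sqrt (b * x)" for x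
  define D where "D x = ln (2 / (c * b)) + 2 * sqrt (b / x)" for x
  have "edge_rate_integral c b - H b \<le> edge_rate_integral c 0 - H 0"
  proof (rule DERIV_nonpos_imp_decreasing_open[of 0 b "\<lambda>x. edge_rate_integral c x - H x"])
    show "continuous_on {0..b} (\<lambda>x. edge_rate_integral c x - H x)"
      unfolding H_def
      by (intro continuous_intros continuous_on_subset[OF continuous_on_edge_rate_integral[OF assms(1)]])
         (use assms in auto)
    fix x assume x: "0 < x" "x < b"
    have "sqrt (b * x) / (2 * x) * 4 = 2 * sqrt (b / x)"
      using x assms by (simp add: real_sqrt_mult real_sqrt_divide field_simps)
    then have "(H has_real_derivative D x) (at x)"
      unfolding H_def D_def using x assms
      by (auto intro!: derivative_eq_intros simp: real_sqrt_mult real_sqrt_divide field_simps)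
    then have der: "((\<lambda>x. edge_rate_integral c x - H x) has_real_derivative edge_rate c x - D x) (at x)"
      using has_real_derivative_edge_rate_integral[OF assms(1) x(1)] by (intro DERIV_diff)
    have cx: "0 < c * x" "c * x \<le> 1"
    proof -
      show "0 < c * x" using assms x by simp
      have "c * x \<le> c * b" using assms(1) x by (intro mult_left_mono) auto
      then show "c * x \<le> 1" using assms(3) by linarith
    qed
    \<comment> \<open>With \<open>u = c * x\<close> in \<open>(0, 1]\<close>, the aim is
      \<open>exp (- u) \<le> 1 - u / 2\<close>: multiplied by \<open>1 + u\<close>, the two sides
      are separated by 1.\<close>
    have "exp (- (c * x)) * (1 + c * x) \<le> exp (- (c * x)) * exp (c * x)"
      by (intro mult_left_mono exp_ge_add_one_self) simp
    then have "exp (- (c * x)) * (1 + c * x) \<le> 1" by (simp flip: exp_add)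
    moreover have "1 \<le> (1 - c * x / 2) * (1 + c * x)"
      using cx mult_left_mono[OF cx(2), of "c * x"] by (simp add: algebra_simps)
    ultimately have "exp (- (c * x)) * (1 + c * x) \<le> (1 - c * x / 2) * (1 + c * x)" by simp
    then have "exp (- (c * x)) \<le> 1 - c * x / 2" using cx by (simp add: mult_le_cancel_right)
    then have "ln (c * x / 2) \<le> ln (1 - exp (- c * x))" using cx by (intro ln_mono) auto
    then have "edge_rate c x \<le> - ln (c * x / 2)" by (simp add: edge_rate_def)
    also have "\<dots> = ln (2 / (c * b)) + ln (b / x)"
      using assms x by (simp add: ln_div ln_mult)
    also have "ln (b / x) = 2 * ln (sqrt (b / x))"
      using assms x by (simp add: ln_sqrt)
    also have "\<dots> \<le> 2 * sqrt (b / x)" using assms x by (intro mult_left_mono ln_bound) auto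
    finally have "edge_rate c x - D x \<le> 0" by (simp add: D_def)
    with der show "\<exists>y. ((\<lambda>x. edge_rate_integral c x - H x) has_real_derivative y) (at x) \<and> y \<le> 0"
      by blast
  qed (use assms in auto)
  moreover have "H 0 = 0" "H b = b * ln (2 / (c * b)) + 4 * b"
    using assms by (auto simp: H_def)
  ultimately show ?thesis by simp
qed

text \<open>By monotonicity the antiderivatives depending on \<open>t\<close> contribute at most 0;
  only \<open>edge_rate_integral c \<beta>\<close> remains.\<close>

lemma dim_rate_le:
  assumes "c \<ge> 1" "0 < \<beta>" "c * \<beta> \<le> 1" "0 < \<xi>" "0 \<le> t" "\<xi> + t \<le> 1/2"
  shows "dim_rate c \<xi> \<beta> t \<le>
    \<beta> * (ln (exp 1 * \<xi> / \<beta>) - c * (1/2 - \<xi> - t) + ln (2 / (c * \<beta>)) + 4)"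
proof -
  have c: "c > 0" using assms by simp
  have "edge_rate_integral c t \<le> edge_rate_integral c (\<beta> + t)"
    "edge_rate_integral c (1/2 - \<xi> - t) \<le> edge_rate_integral c (1/2 - \<xi>)"
    using assms by (intro edge_rate_integral_mono; simp)+
  moreover note edge_rate_integral_le[OF c assms(2,3)]
  ultimately show ?thesis unfolding dim_rate_eq by (simp add: algebra_simps)
qed

text \<open>With \<open>\<beta> = exp (- c / 5)\<close> the two logarithms contribute at most
  \<open>2 * c / 5\<close> up to constants, against a loss of \<open>48 * c / 100\<close>. The
  resulting bound is \<open>exp (c / 5) / 200\<close>, which still beats
  \<open>exp (c / 6)\<close>.\<close>

lemma eventually_dim_rate_negative:
  "eventually (\<lambda>c. alpha c \<le> 1/100 \<and>
     (SUP t\<in>{0..alpha c}. dim_rate c (1/100) (exp (- c / 5)) t) < 0 \<and>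
     exp (c / 6) \<le> (1/100) / (2 * exp (- c / 5))) at_top"
proof -
  have "eventually (\<lambda>c::real. c \<ge> 100) at_top" by (rule eventually_ge_at_top)
  \<comment> \<open>The defining expression of \<open>alpha c\<close> at 1/100; a value below 1 puts
    \<open>alpha c\<close> below 1/100.\<close>
  moreover have "eventually (\<lambda>c::real. exp 2 / (1/100)\<^sup>2 * exp (- c * (1/100)) < 1) at_top"
    by real_asymp
  moreover have "eventually (\<lambda>c::real. c * exp (- c / 5) \<le> 1) at_top" by real_asymp
  moreover have "eventually (\<lambda>c::real. exp (c / 6) \<le> (1/100) / (2 * exp (- c / 5))) at_top"
    by real_asymp
  ultimately show ?thesis
  proof eventually_elim
    case (elim c)
    then have c: "c > 0" by simp
    define \<beta> where "\<beta> = exp (- c / 5)"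
    have \<beta>: "\<beta> > 0" "ln \<beta> = - c / 5" "c * \<beta> \<le> 1" using elim by (auto simp: \<beta>_def)
    have a: "alpha c \<le> 1/100"
      using alpha_properties(3)[OF c, of "1/100"] elim(2) by simp
    have "dim_rate c (1/100) \<beta> t \<le> - \<beta>" if t: "t \<in> {0..alpha c}" for t
    proof -
      have "dim_rate c (1/100) \<beta> t \<le>
        \<beta> * (ln (exp 1 * (1/100) / \<beta>) - c * (1/2 - 1/100 - t) + ln (2 / (c * \<beta>)) + 4)"
        using elim(1) \<beta> t a by (intro dim_rate_le) auto
      also have "\<dots> \<le> \<beta> * (- 1)"
      proof (rule mult_left_mono)
        have "ln (exp 1 * (1/100) / \<beta>) = 1 + ln (1/100) + c / 5"
          using \<beta> by (simp add: ln_div ln_mult)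
        moreover have "ln (2 / (c * \<beta>)) = ln 2 - ln c + c / 5"
          using \<beta> c by (simp add: ln_div ln_mult)
        moreover have "ln (1/100::real) \<le> 0" "ln (2::real) \<le> 1" "0 \<le> ln c"
          using elim(1) ln_2_less_1 by auto
        moreover have "c * t \<le> c * (1/100)" using t a c by (intro mult_left_mono) auto
        then have "c * (1/2 - 1/100 - t) \<ge> c * (48/100)" by (simp add: algebra_simps)
        \<comment> \<open>The slack \<open>8 * c / 100\<close> is at least 8 for
          \<open>c \<ge> 100\<close> and absorbs the constants, which total at most 6.\<close>
        ultimately show "ln (exp 1 * (1/100) / \<beta>) - c * (1/2 - 1/100 - t) + ln (2 / (c * \<beta>)) + 4 \<le> - 1"
          using elim(1) by linarith
      qed (use \<beta> in simp)
      finally show ?thesis by simp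
    qed
    then have "(SUP t\<in>{0..alpha c}. dim_rate c (1/100) \<beta> t) \<le> - \<beta>"
      using alpha_properties(1)[OF c] by (intro cSUP_least) auto
    then have "(SUP t\<in>{0..alpha c}. dim_rate c (1/100) \<beta> t) < 0" using \<beta>(1) by linarith
    then show ?case using a elim(4) unfolding \<beta>_def by blast
  qed
qed

section \<open>The weight of a small explored set\<close>

lemma power_eq_exp: "exp (- (c / n)) ^ j = exp (- c * (real j / n))" for c n :: real
  by (simp flip: exp_of_nat_mult)

lemma one_minus_power_edge_rate:
  fixes c n :: real
  assumes "c > 0" "n > 0" "j \<ge> 1"
  shows "1 - exp (- (c / n)) ^ j = exp (- edge_rate c (real j / n))"
  unfolding power_eq_exp using assms by (intro exp_minus_edge_rate[symmetric]) auto

lemma binomial_rate_le: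
  fixes \<xi> \<beta> :: real
  assumes "\<xi> > 0" "\<beta> > 0" "n \<ge> 1" "\<beta> * real n \<le> real r" "real r \<le> \<beta> * real n + 1" "real m \<le> \<xi> * real n"
  shows "real (m choose r) \<le> (1 + exp 1 * \<xi> / \<beta>) * exp (real n * (\<beta> * ln (exp 1 * \<xi> / \<beta>)))"
proof -
  define u where "u = exp 1 * \<xi> / \<beta>"
  have u: "u > 0" using assms by (simp add: u_def)
  have "0 < \<beta> * real n" using assms by simp
  then have r: "real r > 0" using assms(4) by linarith
  have "real (m choose r) \<le> (exp 1 * real m / real r) ^ r"
    using r by (intro binomial_le_exp_power) simp
  also have "\<dots> \<le> u ^ r"
  proof (rule power_mono)
    have "exp 1 * real m / real r \<le> exp 1 * (\<xi> * real n) / (\<beta> * real n)"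
      using assms r by (intro frac_le mult_left_mono) auto
    then show "exp 1 * real m / real r \<le> u" using assms by (simp add: u_def)
  qed simp
  also have "\<dots> = u powr real r" using u by (simp add: powr_realpow)
  \<comment> \<open>Rounding \<open>r\<close> up costs a factor of at most \<open>u\<close> if
    \<open>u \<ge> 1\<close> and nothing otherwise; \<open>1 + u\<close> covers both cases.\<close>
  also have "\<dots> \<le> (1 + u) * u powr (\<beta> * real n)"
  proof (cases "u \<ge> 1")
    case True
    then have "u powr real r \<le> u powr (\<beta> * real n + 1)" using assms by (intro powr_mono) auto
    also have "\<dots> = u * u powr (\<beta> * real n)" using u by (simp add: powr_add)
    also have "\<dots> \<le> (1 + u) * u powr (\<beta> * real n)" by (intro mult_right_mono) auto
    finally show ?thesis .
  next
    case False
    then have "u powr real r \<le> 1 * u powr (\<beta> * real n)" using assms u by (simp add: powr_mono')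
    also have "\<dots> \<le> (1 + u) * u powr (\<beta> * real n)" using u by (intro mult_right_mono) auto
    finally show ?thesis .
  qed
  also have "u powr (\<beta> * real n) = exp (real n * (\<beta> * ln u))"
    using u by (simp add: powr_def mult_ac)
  finally show ?thesis by (simp add: u_def)
qed

text \<open>Collects the errors that do not grow with \<open>n\<close>: rounding in the binomial
  coefficient, the corrections \<open>1 + 2 * p\<close>, and shifts of the arguments by at most
  \<open>3 / n\<close>.\<close>

definition reach_const :: "real \<Rightarrow> real \<Rightarrow> real \<Rightarrow> real \<Rightarrow> real" where
  "reach_const c \<xi> \<beta> a = (1 + exp 1 * \<xi> / \<beta>) * exp (2 * c) *
     exp (edge_rate c \<beta> + c * \<beta> + 3 * edge_rate c (1/2 - \<xi> - a))"

text \<open>The left side is the expected number of \<open>r\<close>-subsets of an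
  \<open>m\<close>-set whose exploration gains exactly \<open>s\<close> vertices. Its four factors
  are bounded in \<open>P1\<close> to \<open>P4\<close>, each giving one group of terms of
  \<open>dim_rate_eq\<close>.\<close>

lemma reach_weight_le:
  fixes c \<xi> \<beta> a :: real and n m r k s :: nat
  defines "p \<equiv> c / real n" and "t \<equiv> real s / real n"
  assumes pos: "c > 0" "\<xi> > 0" "\<beta> > 0" and a: "0 \<le> a" "a < 1/2 - \<xi>"
    and n: "n \<ge> 1" "p \<le> 1/2" "a * real n \<le> (1/2 - \<xi>) * real n - 1"
    and r: "\<beta> * real n \<le> real r" "real r \<le> \<beta> * real n + 1" and m: "real m \<le> \<xi> * real n"
    and k: "(1/2 - \<xi>) * real n - 1 \<le> real k" "real k \<le> (1/2 - \<xi>) * real n + 2"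
    and s: "real s \<le> a * real n"
  shows "real (m choose r) * ((\<Prod>i<s. 1 - (1 - p) ^ (r + i)) * (1 - p) ^ (r * (k - s)) *
      qbinomial (1 - p) k s) \<le> reach_const c \<xi> \<beta> a * exp (real n * dim_rate c \<xi> \<beta> t)"
proof -
  define N where "N = real n"
  define B where "B = 1/2 - \<xi>"
  define Q where "Q = exp (- p)"
  define J where "J = edge_rate_integral c"
  have N: "N > 0" using n by (simp add: N_def)
  have p: "0 < p" "p \<le> 1/2" "p = c / N" using pos n N by (auto simp: p_def N_def)
  have t: "0 \<le> t" "t \<le> a" "t * N = real s"
    using s N by (auto simp: t_def N_def field_simps)
  have sk: "s \<le> k" using s n(3) k(1) by linarith
  have r1: "r \<ge> 1"
  proof -
    have "0 < \<beta> * real n" using pos n by simp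
    then show ?thesis using r(1) by simp
  qed
  have qQ: "1 - p \<le> Q" unfolding Q_def using exp_ge_add_one_self[of "- p"] by simp
  have sn: "real s \<le> N"
  proof -
    have "a * N \<le> 1 * N" using a pos N by (intro mult_right_mono) auto
    then show ?thesis using s by (simp add: N_def)
  qed
  have P1: "real (m choose r) \<le> (1 + exp 1 * \<xi> / \<beta>) * exp (N * (\<beta> * ln (exp 1 * \<xi> / \<beta>)))"
    unfolding N_def using pos(2,3) n(1) r m by (rule binomial_rate_le)
  \<comment> \<open>The hits form a left Riemann sum starting at \<open>r / N\<close>. Moving its
    start to \<open>\<beta>\<close> costs at most \<open>edge_rate c \<beta>\<close> in the
    exponent.\<close>
  have P2: "(\<Prod>i<s. 1 - (1 - p) ^ (r + i)) \<le>
      exp (2 * c) * exp (- (N * (J (\<beta> + t) - J \<beta>)) + edge_rate c \<beta>)"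
  proof -
    have "(\<Prod>i<s. 1 - (1 - p) ^ (r + i)) \<le>
        (\<Prod>i<s. (1 + 2 * p) * exp (- edge_rate c ((real r + real i) / N)))"
    proof (rule prod_mono, rule conjI)
      fix i
      show "0 \<le> 1 - (1 - p) ^ (r + i)"
        using power_le_one[of "1 - p" "r + i"] p(1,2) by simp
      have "1 - (1 - p) ^ (r + i) \<le> (1 + 2 * p) * (1 - exp (- p) ^ (r + i))"
        using p by (intro one_minus_power_le) auto
      also have "1 - exp (- p) ^ (r + i) = exp (- edge_rate c ((real r + real i) / N))"
        unfolding p(3) using one_minus_power_edge_rate[of c N "r + i"] pos N r1 by simp
      finally show "1 - (1 - p) ^ (r + i) \<le>
        (1 + 2 * p) * exp (- edge_rate c ((real r + real i) / N))" .
    qed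
    also have "\<dots> = (1 + 2 * p) ^ s * exp (- (\<Sum>i<s. edge_rate c ((real r + real i) / N)))"
      by (simp add: prod.distrib exp_sum sum_negf[symmetric])
    also have "\<dots> \<le> exp (2 * c) * exp (- (N * (J (\<beta> + t) - J \<beta>)) + edge_rate c \<beta>)"
    proof (rule mult_mono)
      have "(1 + 2 * p) ^ s \<le> exp (2 * p) ^ s"
        using p by (intro power_mono exp_ge_add_one_self) auto
      also have "\<dots> = exp (2 * (p * real s))" by (simp flip: exp_of_nat_mult add: mult_ac)
      also have "\<dots> \<le> exp (2 * c)"
      proof -
        have "p * real s \<le> p * N" using sn p by (intro mult_left_mono) auto
        then show ?thesis using N by (simp add: p(3))
      qed
      finally show "(1 + 2 * p) ^ s \<le> exp (2 * c)" .
      have "N * (J ((real r + real s) / N) - J (real r / N)) \<le>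
          (\<Sum>i<s. edge_rate c ((real r + real i) / N))"
        unfolding J_def using pos N r1 by (intro sum_edge_rate_ge) auto
      moreover have "J (\<beta> + t) \<le> J ((real r + real s) / N)"
        unfolding J_def
      proof (rule edge_rate_integral_mono)
        show "\<beta> + t \<le> (real r + real s) / N"
          using N r(1) t(3) by (simp add: field_simps N_def)
      qed (use pos t in auto)
      moreover have "J (real r / N) - J \<beta> \<le> edge_rate c \<beta> * (1 / N)"
      proof -
        have "\<beta> \<le> real r / N" using N r(1) by (simp add: field_simps N_def)
        then have "J (real r / N) - J \<beta> \<le> edge_rate c \<beta> * (real r / N - \<beta>)"
          unfolding J_def by (rule edge_rate_integral_diff_le[OF pos(1,3)])
        also have "(real r - \<beta> * N) / N \<le> 1 / N"
          using N r(2) by (intro divide_right_mono) (auto simp: N_def)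
        then have "real r / N - \<beta> \<le> 1 / N" using N by (simp add: diff_divide_distrib)
        then have "edge_rate c \<beta> * (real r / N - \<beta>) \<le> edge_rate c \<beta> * (1 / N)"
          using pos by (intro mult_left_mono edge_rate_nonneg)
        finally show ?thesis .
      qed
      then have "N * (J (real r / N) - J \<beta>) \<le> edge_rate c \<beta>"
        using N by (simp add: field_simps)
      moreover have "N * J (\<beta> + t) \<le> N * J ((real r + real s) / N)"
        using calculation(2) N by (intro mult_left_mono) auto
      ultimately show "exp (- (\<Sum>i<s. edge_rate c ((real r + real i) / N))) \<le>
          exp (- (N * (J (\<beta> + t) - J \<beta>)) + edge_rate c \<beta>)"
        by (simp add: algebra_simps)
    qed auto
    finally show ?thesis .
  qed
  \<comment> \<open>The misses; here \<open>1 - p \<le> exp (- p)\<close> points the right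
    way.\<close>
  have P3: "(1 - p) ^ (r * (k - s)) \<le> exp (- (N * (c * \<beta> * (B - t))) + c * \<beta>)"
  proof -
    have "(1 - p) ^ (r * (k - s)) \<le> Q ^ (r * (k - s))"
      using p(1,2) qQ by (intro power_mono) auto
    also have "\<dots> = exp (- (p * (real r * real (k - s))))"
      unfolding Q_def by (simp flip: exp_of_nat_mult add: mult_ac)
    also have "\<dots> \<le> exp (- (N * (c * \<beta> * (B - t))) + c * \<beta>)"
    proof -
      have "N * (B - t) - 1 \<le> real (k - s)"
        using k(1) sk t(3) by (simp add: of_nat_diff B_def N_def algebra_simps)
      then have "c * \<beta> * (N * (B - t) - 1) \<le> c * \<beta> * real (k - s)"
        using pos by (intro mult_left_mono) auto
      also have "\<dots> = p * (\<beta> * N * real (k - s))" using N by (simp add: p(3))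
      also have "\<dots> \<le> p * (real r * real (k - s))"
        using r(1) p by (intro mult_left_mono mult_right_mono) (auto simp: N_def)
      finally show ?thesis by (simp add: algebra_simps)
    qed
    finally show ?thesis .
  qed
  \<comment> \<open>The product formula turns the coefficient at \<open>Q = exp (- p)\<close> into a
    quotient, hence into a difference of two sums of \<open>edge_rate\<close>.\<close>
  have P4: "qbinomial (1 - p) k s \<le>
      exp (N * J t - N * (J B - J (B - t)) + 3 * edge_rate c (B - a))"
  proof -
    have "qbinomial (1 - p) k s \<le> qbinomial Q k s"
      using p(1,2) qQ by (intro qbinomial_mono) auto
    also have "\<dots> = exp ((\<Sum>j<s. edge_rate c (real (Suc j) / N)) -
        (\<Sum>i<s. edge_rate c (real (k - i) / N)))"
    proof -
      have "(\<Prod>j<s. 1 - Q ^ Suc j) = exp (- (\<Sum>j<s. edge_rate c (real (Suc j) / N)))"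
        unfolding Q_def p(3) using one_minus_power_edge_rate[of c N "Suc j" for j] pos N
        by (simp add: exp_sum sum_negf[symmetric] del: power_Suc of_nat_Suc)
      moreover have "(\<Prod>i<s. 1 - Q ^ (k - i)) = exp (- (\<Sum>i<s. edge_rate c (real (k - i) / N)))"
        unfolding sum_negf[symmetric] exp_sum[OF finite_lessThan] Q_def p(3)
        using pos N sk by (intro prod.cong refl one_minus_power_edge_rate) auto
      ultimately have e: "qbinomial Q k s * exp (- (\<Sum>j<s. edge_rate c (real (Suc j) / N))) =
          exp (- (\<Sum>i<s. edge_rate c (real (k - i) / N)))"
        using qbinomial_product[of Q k s] by metis
      have "x = exp (X - Y)" if "x * exp (- X) = exp (- Y)" for x X Y :: real
        using that by (simp add: exp_diff exp_minus field_simps)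
      from this[OF e] show ?thesis .
    qed
    also have "\<dots> \<le> exp (N * J t - N * (J B - J (B - t)) + 3 * edge_rate c (B - a))"
    proof -
      have 1: "(\<Sum>j<s. edge_rate c (real (Suc j) / N)) \<le> N * J t"
        unfolding J_def t_def using sum_edge_rate_le[OF pos(1) N, of s] by (simp add: N_def)
      \<comment> \<open>Reversing the index makes the arguments increase from
        \<open>x = k - s + 1\<close>, as \<open>sum_edge_rate_ge\<close> expects.\<close>
      define x where "x = real (k - s) + 1"
      have x: "x > 0" "x = real k - real s + 1" using sk by (auto simp: x_def of_nat_diff)
      have "(\<Sum>i<s. edge_rate c (real (k - i) / N)) = (\<Sum>i<s. edge_rate c (real (k - (s - Suc i)) / N))"
        by (rule sum.nat_diff_reindex[symmetric])
      also have "\<dots> = (\<Sum>i<s. edge_rate c ((x + real i) / N))"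
        using sk by (intro sum.cong refl) (simp add: x(2) of_nat_diff algebra_simps)
      finally have 2: "N * (J ((x + real s) / N) - J (x / N)) \<le>
          (\<Sum>i<s. edge_rate c (real (k - i) / N))"
        using sum_edge_rate_ge[OF pos(1) N x(1), of s] by (simp add: J_def)
      have "J B \<le> J ((x + real s) / N)"
        unfolding J_def
      proof (rule edge_rate_integral_mono)
        show "B \<le> (x + real s) / N" using N k(1) by (simp add: x(2) B_def N_def field_simps)
      qed (use pos a in \<open>auto simp: B_def\<close>)
      then have 3: "N * J B \<le> N * J ((x + real s) / N)" using N by (intro mult_left_mono) auto
      \<comment> \<open>The distance \<open>B - a\<close> from the singularity bounds
        \<open>edge_rate\<close> uniformly in \<open>t\<close>, so the constant does not depend on
        \<open>s\<close>.\<close>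
      have Bt: "0 < B - a" "B - a \<le> B - t" using a t by (auto simp: B_def)
      have "J (x / N) \<le> J (B - t + 3 / N)"
        unfolding J_def
      proof (rule edge_rate_integral_mono)
        \<comment> \<open>The upper slack 2 in \<open>k\<close> and the 1 in the definition of
          \<open>x\<close> add up to 3.\<close>
        have "x \<le> (B - t) * N + 3"
          using k(2) t(3) by (simp add: x(2) B_def N_def algebra_simps)
        then have "x / N \<le> ((B - t) * N + 3) / N" using N by (intro divide_right_mono) auto
        then show "x / N \<le> B - t + 3 / N" using N by (simp add: add_divide_distrib)
      qed (use pos x N in auto)
      also have "\<dots> \<le> J (B - t) + edge_rate c (B - t) * (3 / N)"
        using edge_rate_integral_diff_le[OF pos(1), of "B - t" "B - t + 3 / N"] Bt N
        by (simp add: J_def)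
      also have "\<dots> \<le> J (B - t) + edge_rate c (B - a) * (3 / N)"
        using edge_rate_antimono[OF pos(1) Bt] N by (intro add_left_mono mult_right_mono) auto
      finally have "N * J (x / N) \<le> N * (J (B - t) + edge_rate c (B - a) * (3 / N))"
        using N by (intro mult_left_mono) auto
      also have "\<dots> = N * J (B - t) + 3 * edge_rate c (B - a)"
        using N by (simp add: distrib_left)
      finally have 4: "N * J (x / N) \<le> N * J (B - t) + 3 * edge_rate c (B - a)" .
      show ?thesis using 1 2 3 4 by (simp add: algebra_simps)
    qed
    finally show ?thesis .
  qed
  have nn: "0 \<le> (\<Prod>i<s. 1 - (1 - p) ^ (r + i))" "0 \<le> (1 - p) ^ (r * (k - s))"
    "0 \<le> qbinomial (1 - p) k s"
    using p(1,2) by (auto intro!: prod_nonneg qbinomial_nonneg simp: power_le_one)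
  have "real (m choose r) * ((\<Prod>i<s. 1 - (1 - p) ^ (r + i)) * (1 - p) ^ (r * (k - s)) *
      qbinomial (1 - p) k s) \<le>
    ((1 + exp 1 * \<xi> / \<beta>) * exp (N * (\<beta> * ln (exp 1 * \<xi> / \<beta>)))) *
    ((exp (2 * c) * exp (- (N * (J (\<beta> + t) - J \<beta>)) + edge_rate c \<beta>)) *
     exp (- (N * (c * \<beta> * (B - t))) + c * \<beta>) *
     exp (N * J t - N * (J B - J (B - t)) + 3 * edge_rate c (B - a)))"
    using pos by (intro mult_mono P1 P2 P3 P4 mult_nonneg_nonneg nn) auto
  also have "\<dots> = reach_const c \<xi> \<beta> a * exp (N * dim_rate c \<xi> \<beta> t)"
  proof -
    have e: "(x * exp d1) * ((y * exp d2) * exp d3 * exp d4) = x * y * exp z * exp w"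
      if "d1 + d2 + d3 + d4 = z + w" for x y d1 d2 d3 d4 z w :: real
    proof -
      have "exp d1 * exp d2 * exp d3 * exp d4 = exp z * exp w"
        using that by (simp flip: exp_add)
      then show ?thesis by (simp add: mult_ac)
    qed
    show ?thesis
      unfolding reach_const_def dim_rate_eq
      by (rule e) (simp add: J_def B_def algebra_simps)
  qed
  finally show ?thesis by (simp add: N_def)
qed

section \<open>Probability of the exceptional events\<close>

lemma prob_bex_le:
  assumes "finite I"
  shows "measure_pmf.prob M {x. \<exists>i\<in>I. X i x} \<le> (\<Sum>i\<in>I. measure_pmf.prob M {x. X i x})"
proof -
  have "{x. \<exists>i\<in>I. X i x} = (\<Union>i\<in>I. {x. X i x})" by auto
  then show ?thesis
    using assms by (simp only:) (rule measure_pmf.finite_measure_subadditive_finite, auto)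
qed

text \<open>Union bound over \<open>R\<close> and the number \<open>s\<close> of new vertices. The
  explored set contains \<open>R\<close>, so a size below \<open>a\<close> means
  \<open>s < a - r\<close>.\<close>

lemma prob_small_reach:
  assumes "M \<inter> set vs = {}" "distinct vs" "M \<union> set vs \<subseteq> {1..n}" "0 \<le> p" "p \<le> 1"
  shows "measure_pmf.prob (erdos_renyi n p) {E. \<exists>R\<subseteq>M. card R = r \<and> card (reach E R vs) < a}
    \<le> (\<Sum>s<a - r. real (card M choose r) * ((\<Prod>i<s. 1 - (1 - p) ^ (r + i)) *
      (1 - p) ^ (r * (length vs - s)) * qbinomial (1 - p) (length vs) s))"
proof -
  let ?P = "measure_pmf.prob (erdos_renyi n p)"
  let ?\<R> = "{R. R \<subseteq> M \<and> card R = r}"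
  have M: "finite M" using assms(3) by (auto intro: finite_subset)
  then have fin: "finite ?\<R>" by simp
  have "{E. \<exists>R\<subseteq>M. card R = r \<and> card (reach E R vs) < a} \<subseteq>
    {E. \<exists>z\<in>{..<a - r} \<times> ?\<R>. card (reach E (snd z) vs) = card (snd z) + fst z}"
  proof
    fix E assume "E \<in> {E. \<exists>R\<subseteq>M. card R = r \<and> card (reach E R vs) < a}"
    then obtain R where R: "R \<subseteq> M" "card R = r" "card (reach E R vs) < a" by auto
    have "finite (reach E R vs)"
      by (rule finite_subset[OF reach_subset]) (use R M in \<open>auto intro: finite_subset\<close>)
    then have "r \<le> card (reach E R vs)" using R(2) reach_superset card_mono by metis
    then have "(card (reach E R vs) - r, R) \<in> {..<a - r} \<times> ?\<R> \<and>
      card (reach E R vs) = card R + (card (reach E R vs) - r)" using R by auto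
    then show "E \<in> {E. \<exists>z\<in>{..<a - r} \<times> ?\<R>. card (reach E (snd z) vs) = card (snd z) + fst z}"
      by (metis (mono_tags, lifting) fst_conv mem_Collect_eq snd_conv)
  qed
  then have "?P {E. \<exists>R\<subseteq>M. card R = r \<and> card (reach E R vs) < a} \<le>
    ?P {E. \<exists>z\<in>{..<a - r} \<times> ?\<R>. card (reach E (snd z) vs) = card (snd z) + fst z}"
    by (intro measure_pmf.finite_measure_mono) auto
  also have "\<dots> \<le> (\<Sum>z\<in>{..<a - r} \<times> ?\<R>. ?P {E. card (reach E (snd z) vs) = card (snd z) + fst z})"
    using fin by (intro prob_bex_le) auto
  also have "\<dots> = (\<Sum>s<a - r. \<Sum>R\<in>?\<R>. ?P {E. card (reach E R vs) = card R + s})"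
    by (subst sum.cartesian_product) (simp only: case_prod_unfold)
  also have "\<dots> = (\<Sum>s<a - r. \<Sum>R\<in>?\<R>. (\<Prod>i<s. 1 - (1 - p) ^ (r + i)) *
      (1 - p) ^ (r * (length vs - s)) * qbinomial (1 - p) (length vs) s)"
  proof (intro sum.cong refl)
    fix s R assume R: "R \<in> ?\<R>"
    have "finite R" using R M by (auto intro: finite_subset)
    then show "?P {E. card (reach E R vs) = card R + s} = (\<Prod>i<s. 1 - (1 - p) ^ (r + i)) *
      (1 - p) ^ (r * (length vs - s)) * qbinomial (1 - p) (length vs) s"
      using prob_card_reach[of R vs n p s] R assms by auto
  qed
  finally show ?thesis using n_subsets[OF M, of r] by simp
qed

text \<open>Union bound over the pairs \<open>(S, T)\<close>, each of which must avoid
  \<open>a * a\<close> distinct edges.\<close>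

lemma prob_no_edge_between:
  fixes n h a :: nat
  assumes "h \<le> n" "0 \<le> p" "p \<le> 1"
  shows "measure_pmf.prob (erdos_renyi n p) {E. \<exists>S\<subseteq>{1..h}. \<exists>T\<subseteq>{h+1..n}. card S = a \<and> card T = a \<and>
      \<not> (\<exists>u\<in>S. \<exists>v\<in>T. {u, v} \<in> E)} \<le> (real (n choose a))\<^sup>2 * (1 - p) ^ (a * a)"
proof -
  let ?P = "measure_pmf.prob (erdos_renyi n p)"
  let ?\<S> = "{S. S \<subseteq> {1..h} \<and> card S = a}"
  let ?\<T> = "{T. T \<subseteq> {h+1..n} \<and> card T = a}"
  have fin: "finite ?\<S>" "finite ?\<T>" by simp_all
  have "{E. \<exists>S\<subseteq>{1..h}. \<exists>T\<subseteq>{h+1..n}. card S = a \<and> card T = a \<and> \<not> (\<exists>u\<in>S. \<exists>v\<in>T. {u, v} \<in> E)} =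
    {E. \<exists>z\<in>?\<S> \<times> ?\<T>. \<not> (\<exists>u\<in>fst z. \<exists>v\<in>snd z. {u, v} \<in> E)}"
  proof -
    have "(\<exists>S\<subseteq>{1..h}. \<exists>T\<subseteq>{h+1..n}. card S = a \<and> card T = a \<and> X S T) \<longleftrightarrow>
        (\<exists>z\<in>?\<S> \<times> ?\<T>. X (fst z) (snd z))" for X
      by (simp add: Bex_def) blast
    then show ?thesis by (rule Collect_cong)
  qed
  then have "?P {E. \<exists>S\<subseteq>{1..h}. \<exists>T\<subseteq>{h+1..n}. card S = a \<and> card T = a \<and>
      \<not> (\<exists>u\<in>S. \<exists>v\<in>T. {u, v} \<in> E)} \<le>
    (\<Sum>z\<in>?\<S> \<times> ?\<T>. ?P {E. \<not> (\<exists>u\<in>fst z. \<exists>v\<in>snd z. {u, v} \<in> E)})"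
    by (simp only:) (rule prob_bex_le[OF finite_cartesian_product[OF fin]])
  also have "\<dots> = (\<Sum>z\<in>?\<S> \<times> ?\<T>. (1 - p) ^ (a * a))"
  proof (intro sum.cong refl)
    fix z assume z: "z \<in> ?\<S> \<times> ?\<T>"
    obtain S T where zST: "z = (S, T)" by (cases z)
    have ST: "S \<subseteq> {1..h}" "card S = a" "T \<subseteq> {h+1..n}" "card T = a" using z unfolding zST by auto
    define A where "A = (\<lambda>(u, v). {u, v}) ` (S \<times> T)"
    have lt: "u < v" if "u \<in> S" "v \<in> T" for u v
    proof -
      have "u \<le> h" "h < v" using that ST by auto
      then show ?thesis by simp
    qed
    \<comment> \<open>\<open>S\<close> lies entirely before \<open>T\<close>, so the unordered pair
      determines the ordered one.\<close>
    have "inj_on (\<lambda>(u, v). {u, v}) (S \<times> T)"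
    proof (rule inj_onI)
      fix y z assume *: "y \<in> S \<times> T" "z \<in> S \<times> T" "(\<lambda>(u, v). {u, v}) y = (\<lambda>(u, v). {u, v}) z"
      obtain u v u' v' where [simp]: "y = (u, v)" "z = (u', v')" by (cases y; cases z)
      have "u < v" "u' < v'" using lt * by simp_all
      then show "y = z" using *(3) by (auto simp: doubleton_eq_iff)
    qed
    then have "card A = a * a" unfolding A_def using ST by (simp add: card_image card_cartesian_product)
    moreover have "A \<subseteq> all_edges n"
    proof
      fix e assume "e \<in> A"
      then obtain u v where e: "e = {u, v}" "u \<in> S" "v \<in> T" by (auto simp: A_def)
      have "u \<in> {1..n}" "v \<in> {1..n}" using e ST assms(1) by auto
      then show "e \<in> all_edges n" using e lt[of u v] by (simp add: all_edges_def)
    qed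
    moreover have "{E. \<not> (\<exists>u\<in>S. \<exists>v\<in>T. {u, v} \<in> E)} = {E. E \<inter> A = {}}"
      by (auto simp: A_def)
    ultimately show "?P {E. \<not> (\<exists>u\<in>fst z. \<exists>v\<in>snd z. {u, v} \<in> E)} = (1 - p) ^ (a * a)"
      using erdos_renyi_no_edge[of A n p] assms by (simp only: zST fst_conv snd_conv)
  qed
  also have "\<dots> = real (h choose a) * real (n - h choose a) * (1 - p) ^ (a * a)"
    using n_subsets[of "{1..h}" a] n_subsets[of "{h+1..n}" a] by (simp add: card_cartesian_product)
  also have "\<dots> \<le> real (n choose a) * real (n choose a) * (1 - p) ^ (a * a)"
  proof -
    have "h choose a \<le> n choose a" "n - h choose a \<le> n choose a"
      using assms(1) by (auto intro: binomial_right_mono)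
    then show ?thesis
      using assms(2,3) by (intro mult_right_mono mult_mono) auto
  qed
  finally show ?thesis by (simp add: power2_eq_square)
qed

text \<open>The base on the right is the expression defining \<open>alpha c\<close>, so the bound
  decays geometrically in \<open>a\<close> as soon as \<open>x > alpha c\<close>.\<close>

lemma no_edge_between_weight_le:
  assumes c: "c > 0" "c \<le> real n" and n: "n \<ge> 1" and x: "0 < x" "x * real n \<le> real a"
  shows "(real (n choose a))\<^sup>2 * (1 - c / real n) ^ (a * a) \<le> (exp 2 / x\<^sup>2 * exp (- c * x)) ^ a"
proof -
  have "0 < x * real n" using x n by simp
  then have a: "real a > 0" using x(2) by linarith
  have "real (n choose a) \<le> (exp 1 * real n / real a) ^ a"
    using a by (intro binomial_le_exp_power) simp
  also have "\<dots> \<le> (exp 1 / x) ^ a"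
  proof (rule power_mono)
    show "exp 1 * real n / real a \<le> exp 1 / x"
      using a x by (simp add: field_simps)
  qed simp
  finally have "(real (n choose a))\<^sup>2 \<le> ((exp 1 / x) ^ a)\<^sup>2" by (intro power_mono) auto
  also have "\<dots> = (exp 2 / x\<^sup>2) ^ a"
    by (simp add: power_divide power_mult_distrib flip: power_mult exp_of_nat_mult)
       (simp add: mult.commute)
  finally have 1: "(real (n choose a))\<^sup>2 \<le> (exp 2 / x\<^sup>2) ^ a" .
  have "(1 - c / real n) ^ a \<le> exp (- (c / real n)) ^ a"
    using exp_ge_add_one_self[of "- (c / real n)"] c n by (intro power_mono) (auto simp: field_simps)
  also have "\<dots> = exp (- c * (real a / real n))" by (rule power_eq_exp)
  also have "\<dots> \<le> exp (- c * x)"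
    using x n c by (simp add: field_simps)
  finally have "((1 - c / real n) ^ a) ^ a \<le> exp (- c * x) ^ a"
    using c n by (intro power_mono) (auto simp: field_simps)
  then have 2: "(1 - c / real n) ^ (a * a) \<le> exp (- c * x) ^ a" by (simp add: power_mult)
  have "(real (n choose a))\<^sup>2 * (1 - c / real n) ^ (a * a) \<le> (exp 2 / x\<^sup>2) ^ a * exp (- c * x) ^ a"
    using c n x by (intro mult_mono 1 2) (auto simp: field_simps)
  then show ?thesis by (simp only: power_mult_distrib)
qed

section \<open>Asymptotically almost sure bounds on the dimension\<close>

lemma aasI:
  assumes "\<forall>\<^sub>F n in sequentially. 1 - err n \<le> measure_pmf.prob (M n) {x. Q n x}"
    and "err \<longlonglongrightarrow> (0::real)"
  shows "aas M Q"
  unfolding aas_def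
proof (rule tendsto_sandwich[OF assms(1)])
  show "(\<lambda>n. 1 - err n) \<longlonglongrightarrow> 1" using tendsto_diff[OF tendsto_const assms(2), of 1] by simp
qed auto

lemma prob_ge_one_minus:
  assumes "\<And>x. \<not> Q x \<Longrightarrow> x \<in> B" "measure_pmf.prob M B \<le> e"
  shows "1 - e \<le> measure_pmf.prob M {x. Q x}"
proof -
  have "1 - measure_pmf.prob M {x. Q x} = measure_pmf.prob M (UNIV - {x. Q x})"
    using measure_pmf.prob_compl[of "{x. Q x}" M] by simp
  also have "\<dots> \<le> measure_pmf.prob M B"
    using assms(1) by (intro measure_pmf.finite_measure_mono) auto
  finally show ?thesis using assms(2) by simp
qed

lemma prob_many_comparable_pairs_exp:
  assumes "c > 0" "n \<ge> 1" "c \<le> real n" "x > 0"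
  shows "measure_pmf.prob (erdos_renyi n (c / real n)) {E. x \<le> real (card (comparable_pairs n E))}
    \<le> real n * exp c / x"
proof -
  have p: "0 \<le> c / real n" "c / real n \<le> 1" using assms by auto
  have "(1 + c / real n) ^ n \<le> exp (c / real n) ^ n"
    using assms by (intro power_mono exp_ge_add_one_self) auto
  also have "\<dots> = exp c" using assms by (simp flip: exp_of_nat_mult)
  finally have "real n * (1 + c / real n) ^ n / x \<le> real n * exp c / x"
    using assms by (intro divide_right_mono mult_left_mono) auto
  with prob_many_comparable_pairs[OF p assms(4)] show ?thesis
    by (rule order_trans)
qed

lemma eventually_le_real: "\<forall>\<^sub>F n in sequentially. x \<le> real n"
  using filterlim_real_sequentially by (rule filterlim_at_top[THEN iffD1, rule_format])

text \<open>The expected number of comparable pairs is linear in \<open>n\<close>, while a chain has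
  quadratically many. This serves the small values of \<open>c\<close>.\<close>

lemma aas_poset_dim_ge_2:
  assumes c: "c > 0"
  shows "aas (\<lambda>n. erdos_renyi n (c / real n)) (\<lambda>n E. poset_dim {1..n} (graph_poset n E) \<ge> 2)"
proof (rule aasI)
  show "\<forall>\<^sub>F n in sequentially. 1 - real n * exp c / (real n * (real n - 1) / 2) \<le>
    measure_pmf.prob (erdos_renyi n (c / real n)) {E. poset_dim {1..n} (graph_poset n E) \<ge> 2}"
    using eventually_le_real[of c] eventually_le_real[of 2]
  proof eventually_elim
    case (elim n)
    have pos: "0 < real n * (real n - 1) / 2" using elim by simp
    show ?case
    proof (rule prob_ge_one_minus)
      show "E \<in> {E. real n * (real n - 1) / 2 \<le> real (card (comparable_pairs n E))}"
        if "\<not> 2 \<le> poset_dim {1..n} (graph_poset n E)" for E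
        using poset_dim_ge_2[of n E] that elim by force
      show "measure_pmf.prob (erdos_renyi n (c / real n))
        {E. real n * (real n - 1) / 2 \<le> real (card (comparable_pairs n E))} \<le>
        real n * exp c / (real n * (real n - 1) / 2)"
        using elim c pos by (intro prob_many_comparable_pairs_exp) auto
    qed
  qed
  show "(\<lambda>n. real n * exp c / (real n * (real n - 1) / 2)) \<longlonglongrightarrow> 0" by real_asymp
qed

text \<open>Four unlikely events are excluded: large sets across the middle without an edge, a small
  exploration upwards or downwards, and quadratically many comparable pairs. Otherwise a dimension
  below \<open>\<xi> / (2 * \<beta>)\<close> contradicts
  \<open>card_comparable_pairs_ge\<close>.\<close>

lemma aas_poset_dim_ge:
  fixes c \<xi> \<beta> :: real
  assumes pos: "c > 0" "\<xi> > 0" "\<beta> > 0" and \<xi>: "\<xi> + alpha c < 1/2"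
    and sup: "(SUP t\<in>{0..alpha c}. dim_rate c \<xi> \<beta> t) < 0"
  shows "aas (\<lambda>n. erdos_renyi n (c / real n))
    (\<lambda>n E. real (poset_dim {1..n} (graph_poset n E)) \<ge> \<xi> / (2 * \<beta>))"
proof -
  define \<alpha> where "\<alpha> = alpha c"
  have \<alpha>: "\<alpha> > 0" "\<xi> + \<alpha> < 1/2" using alpha_properties(1)[OF pos(1)] \<xi> by (simp_all add: \<alpha>_def)
  define \<epsilon> where "\<epsilon> = - (SUP t\<in>{0..\<alpha>}. dim_rate c \<xi> \<beta> t)"
  have \<epsilon>_pos: "\<epsilon> > 0" using sup unfolding \<epsilon>_def \<alpha>_def by linarith
  have "compact (dim_rate c \<xi> \<beta> ` {0..\<alpha>})"
    using pos \<alpha> by (intro compact_continuous_image continuous_on_dim_rate) auto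
  then have bdd: "bdd_above (dim_rate c \<xi> \<beta> ` {0..\<alpha>})"
    by (intro bounded_imp_bdd_above compact_imp_bounded)
  have rate: "dim_rate c \<xi> \<beta> t \<le> - \<epsilon>" if "t \<in> {0..\<alpha>}" for t
    unfolding \<epsilon>_def minus_minus using that bdd by (rule cSUP_upper)
  \<comment> \<open>Halfway between \<alpha> and \<alpha> + \<beta>: above \<alpha>, so that \<rho>
    < 1, yet with room for the floor in \<open>a n\<close>.\<close>
  define y where "y = \<alpha> + \<beta> / 2"
  define \<rho> where "\<rho> = exp 2 / y\<^sup>2 * exp (- c * y)"
  have y: "y > 0" using \<alpha> pos by (simp add: y_def)
  have \<rho>: "0 \<le> \<rho>" "\<rho> < 1"
  proof -
    have "alpha c < y" using pos by (simp add: y_def \<alpha>_def)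
    then show "\<rho> < 1" using alpha_properties(3)[OF pos(1) y] by (simp add: \<rho>_def)
  qed (simp add: \<rho>_def)
  define K where "K = reach_const c \<xi> \<beta> \<alpha>"
  \<comment> \<open>At this threshold at most \<open>\<alpha> * n\<close> vertices remain after
    removing the \<open>r \<ge> \<beta> * n\<close> starting ones, which is the range of the rate
    hypothesis.\<close>
  define a where "a n = nat \<lfloor>(\<alpha> + \<beta>) * real n\<rfloor>" for n
  define x where "x n = (\<xi> * real n / 4)\<^sup>2" for n
  define err where "err n = \<rho> ^ a n + 2 * (real n * (K * exp (- \<epsilon> * real n))) + real n * exp c / x n"
    for n
  have K: "K > 0" unfolding K_def reach_const_def using pos by (intro mult_pos_pos add_pos_pos) auto
  have a_le: "real (a n) \<le> (\<alpha> + \<beta>) * real n" "(\<alpha> + \<beta>) * real n - 1 \<le> real (a n)" for n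
  proof -
    have "0 \<le> (\<alpha> + \<beta>) * real n" using \<alpha> pos by simp
    then have "real (a n) = of_int \<lfloor>(\<alpha> + \<beta>) * real n\<rfloor>" by (simp add: a_def)
    then show "real (a n) \<le> (\<alpha> + \<beta>) * real n" "(\<alpha> + \<beta>) * real n - 1 \<le> real (a n)" by linarith+
  qed
  have "filterlim a at_top sequentially"
    unfolding filterlim_at_top
  proof
    fix Z :: nat
    show "\<forall>\<^sub>F n in sequentially. Z \<le> a n"
      using eventually_le_real[of "(real Z + 1) / (\<alpha> + \<beta>)"]
    proof eventually_elim
      case (elim n)
      then have "real Z + 1 \<le> (\<alpha> + \<beta>) * real n" using \<alpha> pos by (simp add: field_simps)
      then show ?case using a_le(2)[of n] by linarith
    qed
  qed
  moreover have "norm \<rho> < 1" using \<rho> by simp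
  ultimately have "(\<lambda>n. \<rho> ^ a n) \<longlonglongrightarrow> 0"
    by (intro filterlim_compose[OF LIMSEQ_power_zero])
  moreover have "(\<lambda>n. 2 * (real n * (K * exp (- \<epsilon> * real n)))) \<longlonglongrightarrow> 0"
    using \<epsilon>_pos by real_asymp
  moreover have "(\<lambda>n. real n * exp c / x n) \<longlonglongrightarrow> 0"
    unfolding x_def using pos(2) by real_asymp
  ultimately have "(\<lambda>n. \<rho> ^ a n + 2 * (real n * (K * exp (- \<epsilon> * real n))) + real n * exp c / x n)
      \<longlonglongrightarrow> 0 + 0 + 0"
    by (intro tendsto_add)
  then have err0: "err \<longlonglongrightarrow> 0" unfolding err_def by simp
  have "\<forall>\<^sub>F n in sequentially. 1 - err n \<le> measure_pmf.prob (erdos_renyi n (c / real n))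
      {E. \<xi> / (2 * \<beta>) \<le> real (poset_dim {1..n} (graph_poset n E))}"
    \<comment> \<open>In order: \<open>n\<close> is positive, \<open>p \<le> 1/2\<close>,
      \<open>\<xi> * n \<ge> 4\<close>, one unit of room below \<open>(1/2 - \<xi>) * n\<close>, and
      \<open>\<beta> * n / 2 \<ge> 1\<close>.\<close>
    using eventually_le_real[of 1] eventually_le_real[of "2 * c"] eventually_le_real[of "4 / \<xi>"]
      eventually_le_real[of "1 / (1/2 - \<xi> - \<alpha>)"] eventually_le_real[of "2 / \<beta>"]
  proof eventually_elim
    case (elim n)
    define p where "p = c / real n"
    let ?P = "measure_pmf.prob (erdos_renyi n p)"
    have n: "n \<ge> 1" using elim(1) by simp
    have p: "0 \<le> p" "p \<le> 1/2" "p \<le> 1" using elim(1,2) pos by (auto simp: p_def field_simps)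
    have n\<xi>: "\<xi> * real n \<ge> 4" using elim(3) pos by (simp add: field_simps)
    have nB: "\<alpha> * real n \<le> (1/2 - \<xi>) * real n - 1"
    proof -
      have "1 \<le> (1/2 - \<xi> - \<alpha>) * real n" using elim(4) \<alpha>(2) by (simp add: field_simps)
      then show ?thesis by (simp add: algebra_simps)
    qed
    have n\<beta>: "\<beta> / 2 * real n \<ge> 1" using elim(5) pos by (simp add: field_simps)
    define h where "h = n div 2"
    define m where "m = nat \<lfloor>\<xi> * real n\<rfloor>"
    define r where "r = nat \<lceil>\<beta> * real n\<rceil>"
    have h: "real n / 2 - 1/2 \<le> real h" "real h \<le> real n / 2" unfolding h_def by linarith+
    have m: "real m \<le> \<xi> * real n" "\<xi> * real n - 1 \<le> real m"
      using n\<xi> unfolding m_def by linarith+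
    have r: "\<beta> * real n \<le> real r" "real r \<le> \<beta> * real n + 1" "real r - 1 \<le> \<beta> * real n"
      using n\<beta> unfolding r_def by linarith+
    have r1: "r \<ge> 1" using r(1) n\<beta> by linarith
    have "\<xi> * real n \<le> 1/2 * real n" using \<alpha> by (intro mult_right_mono) auto
    then have m2: "2 * m \<le> n" using m(1) by linarith
    then have mh: "m \<le> h" "h \<le> n - m" "h \<le> n" unfolding h_def by linarith+
    define vs where "vs = [Suc m..<Suc h]"
    define ws where "ws = rev [Suc h..<Suc (n - m)]"
    \<comment> \<open>Rounding \<open>h\<close> and \<open>m\<close> keeps both lengths between
      \<open>(1/2 - \<xi>) * n - 1\<close> and \<open>(1/2 - \<xi>) * n + 2\<close>, the window of
      \<open>reach_weight_le\<close>.\<close>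
    have len: "length vs = h - m" "length ws = n - m - h"
      by (simp_all add: vs_def ws_def del: upt_Suc)
    have B1: "?P {E. \<exists>S\<subseteq>{1..h}. \<exists>T\<subseteq>{h+1..n}. card S = a n \<and> card T = a n \<and>
        \<not> (\<exists>u\<in>S. \<exists>v\<in>T. {u, v} \<in> E)} \<le> \<rho> ^ a n" (is "measure_pmf.prob _ ?B1 \<le> _")
    proof -
      have "?P ?B1 \<le> (real (n choose a n))\<^sup>2 * (1 - p) ^ (a n * a n)"
        using mh(3) p(1,3) by (rule prob_no_edge_between)
      also have "\<dots> \<le> \<rho> ^ a n"
        unfolding p_def \<rho>_def
      proof (rule no_edge_between_weight_le)
        show "y * real n \<le> real (a n)"
          using a_le(2)[of n] n\<beta> by (simp add: y_def algebra_simps)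
      qed (use pos elim n y in auto)
      finally show ?thesis .
    qed
    \<comment> \<open>Stated for an arbitrary start set and list, as it serves both directions of
      exploration.\<close>
    have small: "?P {E. \<exists>R\<subseteq>M. card R = r \<and> card (reach E R us) < a n} \<le>
        real n * (K * exp (- \<epsilon> * real n))"
      if M: "card M = m" "M \<inter> set us = {}" "distinct us" "M \<union> set us \<subseteq> {1..n}"
        and len: "(1/2 - \<xi>) * real n - 1 \<le> real (length us)"
          "real (length us) \<le> (1/2 - \<xi>) * real n + 2" for M us
    proof -
      have "?P {E. \<exists>R\<subseteq>M. card R = r \<and> card (reach E R us) < a n} \<le>
        (\<Sum>s<a n - r. real (m choose r) * ((\<Prod>i<s. 1 - (1 - p) ^ (r + i)) *
          (1 - p) ^ (r * (length us - s)) * qbinomial (1 - p) (length us) s))"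
        using prob_small_reach[OF M(2-4) p(1,3), of r "a n"] M(1) by simp
      also have "\<dots> \<le> (\<Sum>s<a n - r. K * exp (- \<epsilon> * real n))"
      proof (rule sum_mono)
        fix s assume "s \<in> {..<a n - r}"
        then have "real s + real r \<le> real (a n)" by simp
        then have s: "real s \<le> \<alpha> * real n"
          using a_le(1)[of n] r(1) by (simp add: algebra_simps)
        have "real (m choose r) * ((\<Prod>i<s. 1 - (1 - p) ^ (r + i)) *
          (1 - p) ^ (r * (length us - s)) * qbinomial (1 - p) (length us) s) \<le>
          K * exp (real n * dim_rate c \<xi> \<beta> (real s / real n))"
          unfolding K_def p_def
          by (rule reach_weight_le[OF pos _ _ n p(2)[unfolded p_def] nB r(1,2) m(1) len s])
             (use \<alpha> in auto)
        also have "real s / real n \<in> {0..\<alpha>}" using s n by (simp add: field_simps)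
        then have "real n * dim_rate c \<xi> \<beta> (real s / real n) \<le> real n * - \<epsilon>"
          by (intro mult_left_mono rate) auto
        then have "K * exp (real n * dim_rate c \<xi> \<beta> (real s / real n)) \<le> K * exp (- \<epsilon> * real n)"
          using K by (simp add: mult.commute)
        finally show "real (m choose r) * ((\<Prod>i<s. 1 - (1 - p) ^ (r + i)) *
          (1 - p) ^ (r * (length us - s)) * qbinomial (1 - p) (length us) s) \<le>
          K * exp (- \<epsilon> * real n)" .
      qed
      also have "\<dots> = real (a n - r) * (K * exp (- \<epsilon> * real n))" by simp
      also have "\<dots> \<le> real n * (K * exp (- \<epsilon> * real n))"
      proof (rule mult_right_mono)
        have "\<alpha> * real n \<le> 1 * real n" using \<alpha> pos by (intro mult_right_mono) auto
        then have "real (a n) - real r \<le> real n" using a_le(1)[of n] r(1) by (simp add: algebra_simps)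
        then show "real (a n - r) \<le> real n" by linarith
      qed (use K in simp)
      finally show ?thesis .
    qed
    have B2: "?P {E. \<exists>R\<subseteq>{1..m}. card R = r \<and> card (reach E R vs) < a n} \<le>
        real n * (K * exp (- \<epsilon> * real n))" (is "measure_pmf.prob _ ?B2 \<le> _")
    proof (rule small)
      show "(1/2 - \<xi>) * real n - 1 \<le> real (length vs)" "real (length vs) \<le> (1/2 - \<xi>) * real n + 2"
        unfolding len using h m mh by (simp_all add: of_nat_diff algebra_simps)
    qed (use mh in \<open>auto simp: vs_def simp del: upt_Suc\<close>)
    have B3: "?P {E. \<exists>R\<subseteq>{n-m+1..n}. card R = r \<and> card (reach E R ws) < a n} \<le>
        real n * (K * exp (- \<epsilon> * real n))" (is "measure_pmf.prob _ ?B3 \<le> _")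
    proof (rule small)
      have "real (n - m - h) = real n - real m - real h" using mh m2 by (simp add: of_nat_diff)
      then show "(1/2 - \<xi>) * real n - 1 \<le> real (length ws)"
          "real (length ws) \<le> (1/2 - \<xi>) * real n + 2"
        unfolding len using h m by (simp_all add: algebra_simps)
      show "card {n-m+1..n} = m" using m2 by simp
    qed (use mh in \<open>auto simp: ws_def simp del: upt_Suc\<close>)
    have xn: "x n > 0" using pos n by (simp add: x_def)
    have B4: "?P {E. x n \<le> real (card (comparable_pairs n E))} \<le> real n * exp c / x n"
      (is "measure_pmf.prob _ ?B4 \<le> _")
      unfolding p_def using pos n elim xn by (intro prob_many_comparable_pairs_exp) auto
    show ?case
      unfolding p_def[symmetric]
    proof (rule prob_ge_one_minus)
      fix E assume "\<not> \<xi> / (2 * \<beta>) \<le> real (poset_dim {1..n} (graph_poset n E))"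
      then have k: "real (poset_dim {1..n} (graph_poset n E)) < \<xi> / (2 * \<beta>)" by simp
      show "E \<in> ?B1 \<union> ?B2 \<union> ?B3 \<union> ?B4"
      proof (rule ccontr)
        assume E: "E \<notin> ?B1 \<union> ?B2 \<union> ?B3 \<union> ?B4"
        define k where "k = poset_dim {1..n} (graph_poset n E)"
        have "(m - k * (r - 1))\<^sup>2 \<le> card (comparable_pairs n E)"
          unfolding k_def
        proof (rule card_comparable_pairs_ge[OF n mh(1,2) _ _ _ r1])
          show "\<exists>u\<in>S. \<exists>v\<in>T. {u, v} \<in> E"
            if "S \<subseteq> {1..h}" "T \<subseteq> {h+1..n}" "card S = a n" "card T = a n" for S T
          proof (rule ccontr)
            assume "\<not> ?thesis"
            then have "E \<in> ?B1" using that by (intro CollectI exI[of _ S] exI[of _ T] conjI)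
            then show False using E by simp
          qed
          show "a n \<le> card (reach E R [Suc m..<Suc h])" if "R \<subseteq> {1..m}" "card R = r" for R
            unfolding vs_def[symmetric]
          proof (rule leI, rule notI)
            assume "card (reach E R vs) < a n"
            then have "E \<in> ?B2" using that by (intro CollectI exI[of _ R] conjI)
            then show False using E by simp
          qed
          show "a n \<le> card (reach E R (rev [Suc h..<Suc (n - m)]))"
            if "R \<subseteq> {n-m+1..n}" "card R = r" for R
            unfolding ws_def[symmetric]
          proof (rule leI, rule notI)
            assume "card (reach E R ws) < a n"
            then have "E \<in> ?B3" using that by (intro CollectI exI[of _ R] conjI)
            then show False using E by simp
          qed
        qed
        then have "(real (m - k * (r - 1)))\<^sup>2 \<le> real (card (comparable_pairs n E))"
          by (metis of_nat_le_iff of_nat_power)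
        moreover have "x n \<le> (real (m - k * (r - 1)))\<^sup>2"
          unfolding x_def
        proof (rule power_mono)
          \<comment> \<open>At most \<open>\<xi> * n / 2\<close> of the
            \<open>m \<ge> \<xi> * n - 1\<close> vertices are lost, and
            \<open>\<xi> * n \<ge> 4\<close> leaves at least \<open>\<xi> * n / 4\<close>.\<close>
          have "real (k * (r - 1)) = real k * (real r - 1)" using r1 by (simp add: of_nat_diff)
          also have "\<dots> \<le> real k * (\<beta> * real n)" using r(3) by (intro mult_left_mono) auto
          also have "\<dots> \<le> \<xi> / (2 * \<beta>) * (\<beta> * real n)"
            using k pos by (intro mult_right_mono) (auto simp: k_def)
          also have "\<dots> = \<xi> * real n / 2" using pos by simp
          finally show "\<xi> * real n / 4 \<le> real (m - k * (r - 1))"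
            using m(2) n\<xi> by linarith
        qed (use pos in simp)
        ultimately have "x n \<le> real (card (comparable_pairs n E))" by linarith
        then show False using E by simp
      qed
    next
      have "?P (?B1 \<union> ?B2 \<union> ?B3 \<union> ?B4) \<le> ?P ?B1 + ?P ?B2 + ?P ?B3 + ?P ?B4"
        using measure_Un_le[of "?B1 \<union> ?B2 \<union> ?B3" "erdos_renyi n p" ?B4]
          measure_Un_le[of "?B1 \<union> ?B2" "erdos_renyi n p" ?B3]
          measure_Un_le[of ?B1 "erdos_renyi n p" ?B2] by simp
      also have "\<dots> \<le> err n" unfolding err_def using B1 B2 B3 B4 by linarith
      finally show "?P (?B1 \<union> ?B2 \<union> ?B3 \<union> ?B4) \<le> err n" .
    qed
  qed
  then show ?thesis using err0 by (rule aasI)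
qed

lemma aas_mono:
  assumes "aas M Q" "\<And>n x. Q n x \<Longrightarrow> Q' n x"
  shows "aas M Q'"
  unfolding aas_def
proof (rule tendsto_sandwich[of "\<lambda>n. measure_pmf.prob (M n) {x. Q n x}" _ _ "\<lambda>_. 1"])
  show "\<forall>\<^sub>F n in sequentially. measure_pmf.prob (M n) {x. Q n x} \<le> measure_pmf.prob (M n) {x. Q' n x}"
    using assms(2) by (intro always_eventually allI measure_pmf.finite_measure_mono) auto
qed (use assms(1) in \<open>auto simp: aas_def\<close>)

theorem theorem1p11:
  "(\<forall>c \<xi> \<beta> :: real. c > 0 \<longrightarrow> \<xi> > 0 \<longrightarrow> \<beta> > 0 \<longrightarrow> \<xi> + alpha c < 1/2 \<longrightarrow>
      (SUP t\<in>{0..alpha c}. dim_rate c \<xi> \<beta> t) < 0 \<longrightarrow>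
      aas (\<lambda>n. erdos_renyi n (c / real n))
          (\<lambda>n E. real (poset_dim {1..n} (graph_poset n E)) \<ge> \<xi> / (2 * \<beta>)))
   \<and>
   (\<exists>\<gamma> :: real \<Rightarrow> real. (\<forall>c>0. \<gamma> c > 0) \<and> (\<gamma> \<longlongrightarrow> 1/6) at_top \<and>
      (\<forall>c>0. aas (\<lambda>n. erdos_renyi n (c / real n))
          (\<lambda>n E. real (poset_dim {1..n} (graph_poset n E)) \<ge> exp (\<gamma> c * c))))"
proof (rule conjI)
  obtain c0 where c0: "\<And>c. c \<ge> c0 \<Longrightarrow> alpha c \<le> 1/100 \<and>
     (SUP t\<in>{0..alpha c}. dim_rate c (1/100) (exp (- c / 5)) t) < 0 \<and>
     exp (c / 6) \<le> (1/100) / (2 * exp (- c / 5))"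
    using eventually_dim_rate_negative unfolding eventually_at_top_linorder by blast
  \<comment> \<open>Below \<open>c0\<close> the exponent is chosen to make the bound equal to 2;
    from \<open>c0\<close> on it is constant, so the limit is immediate.\<close>
  define \<gamma> where "\<gamma> c = (if c \<ge> c0 then 1/6 else ln 2 / c)" for c :: real
  have "\<forall>c>0. \<gamma> c > 0" by (simp add: \<gamma>_def)
  moreover have "(\<gamma> \<longlongrightarrow> 1/6) at_top"
    by (rule tendsto_eventually, rule eventually_mono[OF eventually_ge_at_top[of c0]])
       (simp add: \<gamma>_def)
  moreover have "aas (\<lambda>n. erdos_renyi n (c / real n))
      (\<lambda>n E. real (poset_dim {1..n} (graph_poset n E)) \<ge> exp (\<gamma> c * c))" if "c > 0" for c
  proof (cases "c \<ge> c0")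
    case True
    have "aas (\<lambda>n. erdos_renyi n (c / real n))
      (\<lambda>n E. real (poset_dim {1..n} (graph_poset n E)) \<ge> (1/100) / (2 * exp (- c / 5)))"
      using c0[OF True] that by (intro aas_poset_dim_ge) auto
    then show ?thesis
    proof (rule aas_mono)
      fix n E
      assume "real (poset_dim {1..n} (graph_poset n E)) \<ge> (1/100) / (2 * exp (- c / 5))"
      moreover have "exp (\<gamma> c * c) \<le> (1/100) / (2 * exp (- c / 5))"
        using c0[OF True] True by (simp add: \<gamma>_def)
      ultimately show "exp (\<gamma> c * c) \<le> real (poset_dim {1..n} (graph_poset n E))" by linarith
    qed
  next
    case False
    then have "exp (\<gamma> c * c) = 2" using that by (simp add: \<gamma>_def)
    then show ?thesis
      by (intro aas_mono[OF aas_poset_dim_ge_2[OF that]]) simp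
  qed
  ultimately show "\<exists>\<gamma> :: real \<Rightarrow> real. (\<forall>c>0. \<gamma> c > 0) \<and> (\<gamma> \<longlongrightarrow> 1/6) at_top \<and>
      (\<forall>c>0. aas (\<lambda>n. erdos_renyi n (c / real n))
          (\<lambda>n E. real (poset_dim {1..n} (graph_poset n E)) \<ge> exp (\<gamma> c * c)))"
    by blast
qed (use aas_poset_dim_ge in blast)

end
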